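(* Let $H(X,Y,q)$ be the mirror curve polynomial described in the context. There is $\epsilon>0$ such that for every $q\in(\mathbb{C}^* )^p$ with $|q_k|<\epsilon$ for all $k$, the convex subdivision $T$ of $\mathbb{R}^2$ determined by the tropical spine of $A_H$ is dual to the triangulation $T_\Sigma$ of $P$.
   Context: Let $P\subset\mathbb{R}^2$ be a convex lattice polygon with a unimodular triangulation $T_\Sigma$ (triangles with lattice vertices and area $1/2$; vertex set $P\cap\mathbb{Z}^2$), encoding a smooth toric Calabi–Yau 3-fold. Write $P\cap\mathbb{Z}^2=\{b_1,\dots,b_{p+3}\}$, $b_i=(m_i,n_i)$, with $b_1=(1,0)$, $b_2=(0,1)$, $b_3=(0,0)$ and $\sigma_1=\{b_1,b_2,b_3\}$ a triangle of $T_\Sigma$. Let $L=\ker(\mathbb{Z}^{p+3}\to\mathbb{Z}^3,\ e_i\mapsto(m_i,n_i,1))$, $D_i\in L^\vee$ the restriction of the $i$-th coordinate functional; for a triangle $\sigma$ with vertex index set $I'_\sigma$, $\{D_j:j\notin I'_\sigma\}$ is a basis of $L^\vee\otimes\mathbb{Q}$. Fix $H_1,\dots,H_p\in L^\vee\otimes\mathbb{Q}$ with $H_k=\sum_{j\notin I'_\sigma}s^\sigma_{k,j}D_j$, $s^\sigma_{k,j}\in\mathbb{Z}_{\ge0}$, $(s^\sigma_{k,j})$ nondegenerate, for every triangle $\sigma$. Set $a_i(q)=1$ ($i=1,2,3$), $a_i(q)=\prod_k q_k^{s^{\sigma_1}_{k,i}}$ ($i\ge4$), and $H(X,Y,q)=\sum_{i=1}^{p+3}a_i(q)X^{m_i}Y^{n_i}$.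 Amoeba and spine: $A_H=\mathrm{Log}(\{H=0\})\subset\mathbb{R}^2$ with $\mathrm{Log}(x,y)=(\log|x|,\log|y|)$. The Ronkin function is $R_H(w)=\frac{1}{(2\pi)^2}\int_{[0,2\pi]^2}\log|H(e^{w_1+i\theta_1},e^{w_2+i\theta_2},q)|\,d\theta_1d\theta_2$; it is convex, and on each connected component $C$ of $\mathbb{R}^2\setminus A_H$ it is affine, $R_H(w)=\tau_C+\langle\sigma_C,w\rangle$, where $\sigma_C\in\mathbb{Z}^2$ is the order of $C$. The tropical spine is the corner locus (non-differentiability locus) of $S(w)=\max_C(\tau_C+\langle\sigma_C,w\rangle)$, the maximum over all components $C$. It induces a convex subdivision $T$ of $\mathbb{R}^2$: the 2-cells are the closures of the maximal regions where a single affine function $\tau_C+\langle\sigma_C,w\rangle$ attains the maximum, the 1-cells are the segments/rays/lines of the corner locus, the 0-cells their endpoints. Duality: two convex subdivisions $T$ of $K$ and $T_0$ of $K_0$ (in $\mathbb{R}^2$) are dual if there is a bijection $T\to T_0$, $\sigma\mapsto\sigma^*$, such that (1) $\tau\subset\sigma$ iff $\sigma^*\subset\tau^*$, and (2) if $\tau\subset\sigma$ then $\mathrm{cone}(\tau,\sigma)$ is dual to $\mathrm{cone}(\sigma^*,\tau^* )$, where $\mathrm{cone}(\tau,\sigma)=\{t(x-y):x\in\sigma,y\in\tau,t\ge0\}$ and the dual of a convex cone $C'$ is $\{\xi:\langle\xi,x\rangle\le0\ \forall x\in C'\}$. *)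

theory Defs
  imports "HOL-Analysis.Analysis"
begin

definition idx :: "nat \<Rightarrow> nat set" where
  "idx p = {1..p+3}"

definition ptR :: "(nat \<Rightarrow> int \<times> int) \<Rightarrow> nat \<Rightarrow> real \<times> real" where
  "ptR b i = (real_of_int (fst (b i)), real_of_int (snd (b i)))"

definition polygon :: "(nat \<Rightarrow> int \<times> int) \<Rightarrow> nat \<Rightarrow> (real \<times> real) set" where
  "polygon b p = convex hull (ptR b ` idx p)"

definition simp_hull :: "(nat \<Rightarrow> int \<times> int) \<Rightarrow> nat set \<Rightarrow> (real \<times> real) set" where
  "simp_hull b S = convex hull (ptR b ` S)"

definition unimodular_triangle :: "(nat \<Rightarrow> int \<times> int) \<Rightarrow> nat set \<Rightarrow> bool" where
  "unimodular_triangle b \<sigma> \<longleftrightarrow>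
     (\<exists>i j k. \<sigma> = {i, j, k} \<and>
        \<bar>(fst (b j) - fst (b i)) * (snd (b k) - snd (b i))
          - (snd (b j) - snd (b i)) * (fst (b k) - fst (b i))\<bar> = 1)"

definition toric_data :: "(nat \<Rightarrow> int \<times> int) \<Rightarrow> nat \<Rightarrow> nat set set \<Rightarrow> bool" where
  "toric_data b p TS \<longleftrightarrow>
     inj_on b (idx p) \<and>
     b 1 = (1, 0) \<and> b 2 = (0, 1) \<and> b 3 = (0, 0) \<and>
     (\<forall>z :: int \<times> int. (real_of_int (fst z), real_of_int (snd z)) \<in> polygon b p
        \<longleftrightarrow> z \<in> b ` idx p) \<and>
     finite TS \<and>
     (\<forall>\<sigma>\<in>TS. \<sigma> \<subseteq> idx p \<and> unimodular_triangle b \<sigma>) \<and>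
     (\<Union>\<sigma>\<in>TS. simp_hull b \<sigma>) = polygon b p \<and>
     (\<forall>\<sigma>\<in>TS. \<forall>\<tau>\<in>TS. simp_hull b \<sigma> \<inter> simp_hull b \<tau> = simp_hull b (\<sigma> \<inter> \<tau>)) \<and>
     \<Union>TS = idx p \<and>
     {1, 2, 3} \<in> TS"

(* L = ker(Z^{p+3} -> Z^3, e_i |-> (m_i, n_i, 1)) *)
definition inL :: "(nat \<Rightarrow> int \<times> int) \<Rightarrow> nat \<Rightarrow> (nat \<Rightarrow> int) \<Rightarrow> bool" where
  "inL b p l \<longleftrightarrow> (\<forall>j. j \<notin> idx p \<longrightarrow> l j = 0) \<and>
     (\<Sum>j\<in>idx p. l j * fst (b j)) = 0 \<and>
     (\<Sum>j\<in>idx p. l j * snd (b j)) = 0 \<and>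
     (\<Sum>j\<in>idx p. l j) = 0"

(* s \<sigma> k j = s^\<sigma>_{k,j}.  The classes H_k := \<Sum>_{j \<notin> \<sigma>_1} s^{\<sigma>_1}_{k,j} D_j
   satisfy H_k = \<Sum>_{j \<notin> \<sigma>} s^\<sigma>_{k,j} D_j in L^\<or> \<otimes> Q for every triangle \<sigma>
   (equality of functionals on L, which spans L \<otimes> Q), with nonnegative integer
   coefficients (type nat) and nondegenerate p x p coefficient matrices. *)
definition kahler_data ::
  "(nat \<Rightarrow> int \<times> int) \<Rightarrow> nat \<Rightarrow> nat set set \<Rightarrow> (nat set \<Rightarrow> nat \<Rightarrow> nat \<Rightarrow> nat) \<Rightarrow> bool" where
  "kahler_data b p TS s \<longleftrightarrow>
     (\<forall>\<sigma>\<in>TS. \<forall>k\<in>{1..p}. \<forall>l. inL b p l \<longrightarrow>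
        (\<Sum>j\<in>idx p - \<sigma>. int (s \<sigma> k j) * l j) =
        (\<Sum>j\<in>idx p - {1, 2, 3}. int (s {1, 2, 3} k j) * l j)) \<and>
     (\<forall>\<sigma>\<in>TS. \<forall>c :: nat \<Rightarrow> real.
        (\<forall>j\<in>idx p - \<sigma>. (\<Sum>k\<in>{1..p}. c k * real (s \<sigma> k j)) = 0)
        \<longrightarrow> (\<forall>k\<in>{1..p}. c k = 0))"

definition coef_a :: "(nat set \<Rightarrow> nat \<Rightarrow> nat \<Rightarrow> nat) \<Rightarrow> nat \<Rightarrow> (nat \<Rightarrow> complex) \<Rightarrow> nat \<Rightarrow> complex" where
  "coef_a s p q i = (if i \<le> 3 then 1 else (\<Prod>k\<in>{1..p}. q k ^ s {1, 2, 3} k i))"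

definition mirrorH ::
  "(nat \<Rightarrow> int \<times> int) \<Rightarrow> nat \<Rightarrow> (nat set \<Rightarrow> nat \<Rightarrow> nat \<Rightarrow> nat) \<Rightarrow> (nat \<Rightarrow> complex)
     \<Rightarrow> complex \<Rightarrow> complex \<Rightarrow> complex" where
  "mirrorH b p s q X Y = (\<Sum>i\<in>idx p. coef_a s p q i * X powi fst (b i) * Y powi snd (b i))"

definition amoeba :: "(complex \<Rightarrow> complex \<Rightarrow> complex) \<Rightarrow> (real \<times> real) set" where
  "amoeba H = {(ln (cmod x), ln (cmod y)) | x y. x \<noteq> 0 \<and> y \<noteq> 0 \<and> H x y = 0}"

definition ronkin :: "(complex \<Rightarrow> complex \<Rightarrow> complex) \<Rightarrow> real \<times> real \<Rightarrow> real" where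
  "ronkin H w = (1 / (2 * pi) ^ 2) *
     (LINT t1:{0..2*pi}|lborel. LINT t2:{0..2*pi}|lborel.
        ln (cmod (H (exp (Complex (fst w) t1)) (exp (Complex (snd w) t2)))))"

definition comp_affine :: "(complex \<Rightarrow> complex \<Rightarrow> complex) \<Rightarrow> (real \<times> (real \<times> real)) set" where
  "comp_affine H = {(\<tau>, \<sigma>). \<exists>C\<in>components (UNIV - amoeba H).
       \<forall>w\<in>C. ronkin H w = \<tau> + \<sigma> \<bullet> w}"

definition spine_fun :: "(complex \<Rightarrow> complex \<Rightarrow> complex) \<Rightarrow> real \<times> real \<Rightarrow> real" where
  "spine_fun H w = Sup ((\<lambda>(\<tau>, \<sigma>). \<tau> + \<sigma> \<bullet> w) ` comp_affine H)"

definition spine_region :: "(complex \<Rightarrow> complex \<Rightarrow> complex) \<Rightarrow> real \<times> (real \<times> real) \<Rightarrow> (real \<times> real) set" where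
  "spine_region H f = {w. fst f + snd f \<bullet> w = spine_fun H w}"

(* cells of the convex subdivision of R^2 induced by the tropical spine:
   nonempty intersections of the maximal regions of the affine functions
   (2-cells, their common edges and vertices). *)
definition spine_cells :: "(complex \<Rightarrow> complex \<Rightarrow> complex) \<Rightarrow> (real \<times> real) set set" where
  "spine_cells H = {X. X \<noteq> {} \<and>
      (\<exists>G. G \<subseteq> comp_affine H \<and> G \<noteq> {} \<and> X = (\<Inter>f\<in>G. spine_region H f))}"

definition tri_cells :: "(nat \<Rightarrow> int \<times> int) \<Rightarrow> nat set set \<Rightarrow> (real \<times> real) set set" where
  "tri_cells b TS = {simp_hull b S | S \<sigma>. \<sigma> \<in> TS \<and> S \<subseteq> \<sigma> \<and> S \<noteq> {}}"

definition cone_pair :: "(real \<times> real) set \<Rightarrow> (real \<times> real) set \<Rightarrow> (real \<times> real) set" where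
  "cone_pair \<tau> \<sigma> = {t *\<^sub>R (x - y) | t x y. x \<in> \<sigma> \<and> y \<in> \<tau> \<and> t \<ge> 0}"

definition dual_cone :: "(real \<times> real) set \<Rightarrow> (real \<times> real) set" where
  "dual_cone C = {\<xi>. \<forall>x\<in>C. \<xi> \<bullet> x \<le> 0}"

definition dual_subdivisions :: "(real \<times> real) set set \<Rightarrow> (real \<times> real) set set \<Rightarrow> bool" where
  "dual_subdivisions T T0 \<longleftrightarrow> (\<exists>\<phi>. bij_betw \<phi> T T0 \<and>
     (\<forall>\<tau>\<in>T. \<forall>\<sigma>\<in>T. \<tau> \<subseteq> \<sigma> \<longleftrightarrow> \<phi> \<sigma> \<subseteq> \<phi> \<tau>) \<and>
     (\<forall>\<tau>\<in>T. \<forall>\<sigma>\<in>T. \<tau> \<subseteq> \<sigma> \<longrightarrow>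
        cone_pair \<tau> \<sigma> = dual_cone (cone_pair (\<phi> \<sigma>) (\<phi> \<tau>))))"

end

theory Submission
  imports Defs "HOL-Computational_Algebra.Fundamental_Theorem_Algebra"
begin

text \<open>
  On the complement of the amoeba the map \<open>\<theta> \<mapsto> H (exp (w + \<i>\<theta>))\<close> has a continuous logarithm, whose periods
  form the order of \<open>w\<close>; the order is locally constant and is the gradient of the Ronkin function.
  Restricting \<open>H\<close> to an integer direction yields a one-variable polynomial whose number of zeros in a
  disc is the order paired with that direction. Hence orders are lattice points of the Newton polygon,
  and two points of equal order joined by a segment of rational direction lie in one component, so that
  components are determined by their orders.

  The relations between the classes \<open>H\<^sub>k\<close> say that \<open>ln \<bar>a\<^sub>i\<bar>\<close> is strictly concave with respect to the
  triangulation, with a gap tending to infinity as \<open>q\<close> tends to zero. Therefore every monomial dominates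
  somewhere, which makes the affine functions of the spine exactly \<open>\<tau>\<^sub>i + \<langle>b\<^sub>i, w\<rangle>\<close> with
  \<open>\<bar>\<tau>\<^sub>i - ln \<bar>a\<^sub>i\<bar>\<bar> \<le> ln 2\<close>. The perturbed heights \<open>\<tau>\<close> still induce the triangulation, and a regular
  triangulation is dual to the tropical curve of its heights.
\<close>

section \<open>Continuous logarithms and zeros of polynomials\<close>

text \<open>The constants \<open>\<tau> i\<close> of the spine are values of an integral and are
  never computed; they are controlled only up to a bounded error against
  \<open>ln (cmod (a i))\<close>. Hence strict concavity of the latter is not enough, and every
  height argument carries a quantitative gap \<open>M\<close>. The error ln 2 comes from asking that
  one monomial be at least twice the sum of the moduli of all others: the quotient of the polynomial
  by it then has modulus between 1/2 and 3/2. The scale \<open>M\<close> is fixed before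
  \<open>q\<close>; it has to exceed finitely many bounds depending only on the triangulation, and
  \<open>exp (- M)\<close> serves as \<epsilon>. Equal orders at two points mean that a one-variable
  restriction has no zero in the annulus between the two corresponding circles. Counting zeros needs
  a genuine polynomial, so only integer directions are admissible, and openness of the components
  supplies one. Unimodularity enters through integrality: with determinant 1 or -1 the relation
  expressing a lattice point by the vertices of a triangle has integer entries, so it lies in
  \<open>L\<close> and can be paired with the classes.\<close>

lemma continuous_logs_differ_by_period:
  fixes g h :: "'a::topological_space \<Rightarrow> complex"
  assumes "connected S" "continuous_on S g" "continuous_on S h"
    and "\<And>x. x \<in> S \<Longrightarrow> exp (g x) = exp (h x)"
  shows "\<exists>n::int. \<forall>x\<in>S. g x = h x + 2 * pi * n * \<i>"
proof -
  \<comment> \<open>The normalised difference takes integer values, any two of which are at distance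
    at least 1 unless equal, so continuity on a connected set makes it constant.\<close>
  define f where "f = (\<lambda>x. (g x - h x) / (2 * pi * \<i>))"
  have int: "\<exists>n::int. f x = of_int n" if x: "x \<in> S" for x
  proof -
    obtain n :: int where "g x = h x + (of_int (2 * n) * pi) * \<i>"
      using assms(4)[OF x] unfolding exp_eq by blast
    then show ?thesis
      by (intro exI[of _ n]) (simp add: f_def field_simps)
  qed
  have "f constant_on S"
  proof (rule continuous_discrete_range_constant[OF assms(1)])
    show "continuous_on S f"
      unfolding f_def by (intro continuous_intros assms) auto
    fix x assume x: "x \<in> S"
    show "\<exists>e>0. \<forall>y. y \<in> S \<and> f y \<noteq> f x \<longrightarrow> e \<le> norm (f y - f x)"
    proof (intro exI[of _ 1] conjI allI impI)
      fix y assume y: "y \<in> S \<and> f y \<noteq> f x"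
      obtain m n :: int where "f x = of_int m" "f y = of_int n"
        using int x y by blast
      with y have "n - m \<noteq> 0" "f y - f x = of_int (n - m)" by auto
      then show "1 \<le> norm (f y - f x)"
        by (simp only: norm_of_int)
    qed auto
  qed
  then obtain c where c: "\<And>x. x \<in> S \<Longrightarrow> f x = c"
    unfolding constant_on_def by blast
  show ?thesis
  proof (cases "S = {}")
    case False
    then obtain x where "x \<in> S" by auto
    then obtain n :: int where "c = of_int n" using int c by metis
    then have "f y = of_int n" if "y \<in> S" for y using c that by auto
    then show ?thesis
      by (intro exI[of _ n] ballI) (auto simp: f_def field_simps)
  qed auto
qed

text \<open>Winding number about 0 as a relation. A logarithm with this increment already forces
  \<open>f\<close> to be nonvanishing, continuous and closed on the interval.\<close>

definition loop_index :: "(real \<Rightarrow> complex) \<Rightarrow> int \<Rightarrow> bool" where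
  "loop_index f m \<longleftrightarrow> (\<exists>g. continuous_on {0..2*pi} g \<and>
     (\<forall>t\<in>{0..2*pi}. f t = exp (g t)) \<and> g (2*pi) = g 0 + 2 * pi * m * \<i>)"

lemma loop_index_unique:
  assumes "loop_index f m" "loop_index f n"
  shows "m = n"
proof -
  obtain g where g: "continuous_on {0..2*pi} g" "\<And>t. t\<in>{0..2*pi} \<Longrightarrow> f t = exp (g t)"
    "g (2*pi) = g 0 + 2 * pi * m * \<i>"
    using assms(1) unfolding loop_index_def by blast
  obtain h where h: "continuous_on {0..2*pi} h" "\<And>t. t\<in>{0..2*pi} \<Longrightarrow> f t = exp (h t)"
    "h (2*pi) = h 0 + 2 * pi * n * \<i>"
    using assms(2) unfolding loop_index_def by blast
  obtain k :: int where "\<forall>t\<in>{0..2*pi}. g t = h t + 2 * pi * k * \<i>"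
    using continuous_logs_differ_by_period[of "{0..2*pi}" g h] g(1,2) h(1,2)
    by (metis connected_Icc)
  then have "g 0 = h 0 + 2 * pi * k * \<i>" "g (2*pi) = h (2*pi) + 2 * pi * k * \<i>"
    by auto
  with g(3) h(3) have "2 * pi * complex_of_int m * \<i> = 2 * pi * complex_of_int n * \<i>"
    by simp
  then show ?thesis by simp
qed

lemma loop_index_mult:
  assumes "loop_index f m" "loop_index g n"
  shows "loop_index (\<lambda>t. f t * g t) (m + n)"
proof -
  obtain f' g' where "continuous_on {0..2*pi} f'" "\<And>t. t\<in>{0..2*pi} \<Longrightarrow> f t = exp (f' t)"
    "f' (2*pi) = f' 0 + 2 * pi * m * \<i>"
    "continuous_on {0..2*pi} g'" "\<And>t. t\<in>{0..2*pi} \<Longrightarrow> g t = exp (g' t)"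
    "g' (2*pi) = g' 0 + 2 * pi * n * \<i>"
    using assms unfolding loop_index_def by blast
  then show ?thesis
    unfolding loop_index_def
    by (intro exI[of _ "\<lambda>t. f' t + g' t"]) (auto intro!: continuous_intros simp: exp_add algebra_simps)
qed

lemma loop_index_const: "c \<noteq> 0 \<Longrightarrow> loop_index (\<lambda>_. c) 0"
  unfolding loop_index_def by (intro exI[of _ "\<lambda>_. Ln c"]) auto

lemma loop_index_cis_multiple: "loop_index (\<lambda>t. cis (real_of_int n * t)) n"
  unfolding loop_index_def
  by (intro exI[of _ "\<lambda>t. \<i> * (real_of_int n * t)"])
     (auto intro!: continuous_intros simp: cis_conv_exp algebra_simps)

lemma one_minus_slit:
  assumes "cmod z < 1" shows "1 - z \<notin> \<real>\<^sub>\<le>\<^sub>0"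
proof -
  have "Re z < 1" using assms abs_Re_le_cmod[of z] by linarith
  then show ?thesis by (auto simp: complex_nonpos_Reals_iff)
qed

text \<open>The loop stays in the right half-plane, so the principal \<open>Ln\<close> is a
  logarithm along it and returns to its initial value.\<close>

lemma loop_index_one_minus:
  assumes "cmod z < 1"
  shows "loop_index (\<lambda>t. 1 - z * cis (real_of_int n * t)) 0"
proof -
  have slit: "1 - z * cis (real_of_int n * t) \<notin> \<real>\<^sub>\<le>\<^sub>0" for t
    using assms by (intro one_minus_slit) (simp add: norm_mult)
  then have nz: "1 - z * cis (real_of_int n * t) \<noteq> 0" for t
    by (metis complex_nonpos_Reals_iff order_refl zero_complex.sel)
  have per: "cis (real_of_int n * (2 * pi)) = 1"
    using cis_multiple_2pi[of "of_int n"] by (simp add: mult_ac)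
  show ?thesis
    unfolding loop_index_def
  proof (intro exI[of _ "\<lambda>t. Ln (1 - z * cis (real_of_int n * t))"] conjI ballI)
    show "continuous_on {0..2 * pi} (\<lambda>t. Ln (1 - z * cis (real_of_int n * t)))"
      using slit by (intro continuous_intros) auto
  qed (use nz per in auto)
qed

text \<open>Splitting off the larger of the two terms leaves a factor
  \<open>1 - z * cis (n * t)\<close> with \<open>cmod z < 1\<close>, of index 0. The index is thus
  that of \<open>r * cis t\<close> or of the constant \<open>- a\<close>.\<close>

lemma loop_index_linear:
  assumes "r > 0" "cmod a \<noteq> r"
  shows "loop_index (\<lambda>t. complex_of_real r * cis t - a) (if cmod a < r then 1 else 0)"
proof (cases "cmod a < r")
  case True
  have "loop_index (\<lambda>t. complex_of_real r * (cis (real_of_int 1 * t) *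
          (1 - (a / r) * cis (real_of_int (-1) * t)))) (0 + (1 + 0))"
    using assms True
    by (intro loop_index_mult loop_index_const loop_index_cis_multiple loop_index_one_minus)
       (auto simp: norm_divide)
  moreover have "complex_of_real r * (cis (real_of_int 1 * t) *
          (1 - (a / r) * cis (real_of_int (-1) * t))) = complex_of_real r * cis t - a" for t
    using assms(1) by (simp add: algebra_simps cis_mult)
  ultimately show ?thesis using True by simp
next
  case False
  then have a: "cmod a > r" "a \<noteq> 0" using assms by auto
  have "loop_index (\<lambda>t. (- a) * (1 - (r / a) * cis (real_of_int 1 * t))) (0 + 0)"
    using assms(1) a
    by (intro loop_index_mult loop_index_const loop_index_one_minus) (auto simp: norm_divide)
  moreover have "(- a) * (1 - (r / a) * cis (real_of_int 1 * t)) = complex_of_real r * cis t - a" for t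
    using a by (simp add: algebra_simps)
  ultimately show ?thesis using False by simp
qed

lemma loop_index_prod_mset:
  assumes "\<And>a. a \<in># A \<Longrightarrow> cmod a \<noteq> r" "r > 0"
  shows "loop_index (\<lambda>t. \<Prod>a\<in>#A. (complex_of_real r * cis t - a))
           (int (size (filter_mset (\<lambda>a. cmod a < r) A)))"
  using assms(1)
proof (induction A)
  case empty
  then show ?case using loop_index_const[of 1] by simp
next
  case (add x A)
  have "loop_index (\<lambda>t. (complex_of_real r * cis t - x) * (\<Prod>a\<in>#A. (complex_of_real r * cis t - a)))
     ((if cmod x < r then 1 else 0) + int (size (filter_mset (\<lambda>a. cmod a < r) A)))"
    using add assms(2) by (intro loop_index_mult loop_index_linear) auto
  then show ?case by (auto simp: algebra_simps)
qed

text \<open>The argument principle for polynomials, obtained from the factorisation into linear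
  terms; zeros are counted with multiplicity.\<close>

lemma loop_index_poly:
  fixes P :: "complex poly"
  assumes "r > 0" "\<And>z. poly P z = 0 \<Longrightarrow> cmod z \<noteq> r"
  shows "loop_index (\<lambda>t. poly P (complex_of_real r * cis t))
           (int (size (filter_mset (\<lambda>a. cmod a < r) (proots P))))"
proof -
  have P: "P \<noteq> 0" using assms(2)[of "complex_of_real r"] assms(1) by auto
  have "poly P z = lead_coeff P * (\<Prod>a\<in>#proots P. (z - a))" for z
    by (subst complex_poly_decompose_multiset[symmetric])
       (simp add: poly_prod_mset image_mset.compositionality o_def)
  moreover have "loop_index (\<lambda>t. lead_coeff P * (\<Prod>a\<in>#proots P. (complex_of_real r * cis t - a)))
      (0 + int (size (filter_mset (\<lambda>a. cmod a < r) (proots P))))"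
    using P assms by (intro loop_index_mult loop_index_const loop_index_prod_mset) auto
  ultimately show ?thesis by simp
qed

lemma open_contains_rational_point:
  fixes U :: "(real \<times> real) set"
  assumes "open U" "w \<in> U"
  shows "\<exists>(d::int \<times> int) (N::nat). N > 0 \<and>
           (1 / real N) *\<^sub>R (real_of_int (fst d), real_of_int (snd d)) \<in> U"
proof -
  obtain e where e: "e > 0" "ball w e \<subseteq> U" using assms open_contains_ball by blast
  \<comment> \<open>Rounding \<open>N * w\<close> down costs at most \<open>1/N\<close> in each of
    the two coordinates, hence the factor 2.\<close>
  obtain N :: nat where N: "real N > 2 / e" using reals_Archimedean2 by blast
  have "0 < 2 / e" using e by simp
  with N have N0: "real N > 0" by linarith
  have *: "\<bar>x - real_of_int \<lfloor>real N * x\<rfloor> / real N\<bar> \<le> 1 / real N" for x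
  proof -
    have "\<bar>real N * x - real_of_int \<lfloor>real N * x\<rfloor>\<bar> \<le> 1" by linarith
    then have "\<bar>real N * (x - real_of_int \<lfloor>real N * x\<rfloor> / real N)\<bar> \<le> 1"
      using N0 by (simp add: algebra_simps)
    then show ?thesis using N0 by (simp add: abs_mult field_simps)
  qed
  let ?d = "(\<lfloor>real N * fst w\<rfloor>, \<lfloor>real N * snd w\<rfloor>)"
  have "dist w ((1 / real N) *\<^sub>R (real_of_int (fst ?d), real_of_int (snd ?d)))
     \<le> 1 / real N + 1 / real N"
  proof (cases w)
    case (Pair x y)
    have "norm (x', y') \<le> \<bar>x'\<bar> + \<bar>y'\<bar>" for x' y' :: real
      unfolding norm_Pair by (simp add: sqrt_sum_squares_le_sum_abs)
    from this[of "x - real_of_int \<lfloor>real N * x\<rfloor> / real N" "y - real_of_int \<lfloor>real N * y\<rfloor> / real N"]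
    show ?thesis using *[of x] *[of y] Pair by (simp add: dist_norm)
  qed
  also have "\<dots> < e" using N N0 e by (simp add: field_simps)
  finally show ?thesis
    using e N0 by (intro exI[of _ ?d] exI[of _ N]) auto
qed

section \<open>Orders of complement components of an amoeba\<close>

definition rvec :: "int \<times> int \<Rightarrow> real \<times> real" where
  "rvec d = (real_of_int (fst d), real_of_int (snd d))"

definition idot :: "int \<times> int \<Rightarrow> int \<times> int \<Rightarrow> int" where
  "idot m d = fst m * fst d + snd m * snd d"

lemma rvec_inner_rvec: "rvec m \<bullet> rvec d = real_of_int (idot m d)"
  by (simp add: rvec_def idot_def)

locale laurent =
  fixes I :: "'i set" and a :: "'i \<Rightarrow> complex" and e :: "'i \<Rightarrow> int \<times> int"
  assumes finite_I: "finite I"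
begin

definition H :: "complex \<Rightarrow> complex \<Rightarrow> complex" where
  "H X Y = (\<Sum>i\<in>I. a i * X powi fst (e i) * Y powi snd (e i))"

text \<open>The Laurent polynomial in logarithmic polar coordinates: \<open>w\<close> holds the
  logarithms of the moduli and \<open>\<theta>\<close> the arguments. Both are real vectors, so the
  argument torus is seen through its universal cover.\<close>

definition pval :: "real \<times> real \<Rightarrow> real \<times> real \<Rightarrow> complex" where
  "pval w \<theta> = (\<Sum>i\<in>I. a i * exp (of_real (rvec (e i) \<bullet> w) + \<i> * of_real (rvec (e i) \<bullet> \<theta>)))"

lemma H_exp:
  "H (exp (Complex (fst w) (fst \<theta>))) (exp (Complex (snd w) (snd \<theta>))) = pval w \<theta>"
  unfolding H_def pval_def
proof (intro sum.cong refl)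
  fix i
  show "a i * exp (Complex (fst w) (fst \<theta>)) powi fst (e i) * exp (Complex (snd w) (snd \<theta>)) powi snd (e i) =
    a i * exp (of_real (rvec (e i) \<bullet> w) + \<i> * of_real (rvec (e i) \<bullet> \<theta>))"
    by (simp add: exp_power_int exp_add[symmetric] rvec_def inner_prod_def Complex_eq algebra_simps)
qed

lemma amoeba_iff: "w \<in> amoeba H \<longleftrightarrow> (\<exists>\<theta>. pval w \<theta> = 0)"
proof
  assume "w \<in> amoeba H"
  then obtain x y where xy: "w = (ln (cmod x), ln (cmod y))" "x \<noteq> 0" "y \<noteq> 0" "H x y = 0"
    unfolding amoeba_def by blast
  have "exp (Complex (ln (cmod z)) (Arg z)) = z" if "z \<noteq> 0" for z
    using Arg_eq[OF that] that by (simp add: Complex_eq exp_add exp_of_real flip: of_real_exp)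
  with xy have "pval w (Arg x, Arg y) = 0"
    unfolding H_exp[symmetric] by simp
  then show "\<exists>\<theta>. pval w \<theta> = 0" ..
next
  assume "\<exists>\<theta>. pval w \<theta> = 0"
  then obtain \<theta> where "pval w \<theta> = 0" ..
  then show "w \<in> amoeba H"
    unfolding amoeba_def H_exp[symmetric]
    by (intro CollectI exI[of _ "exp (Complex (fst w) (fst \<theta>))"] exI[of _ "exp (Complex (snd w) (snd \<theta>))"])
       simp
qed

lemma exp_real_add_i: "exp (of_real x + \<i> * of_real y) = of_real (exp x) * cis y"
  by (simp add: exp_add cis_conv_exp flip: of_real_exp)

lemma pval_periodic: "pval w (\<theta> + (2 * pi) *\<^sub>R rvec d) = pval w \<theta>"
proof -
  have "cis (rvec (e i) \<bullet> (\<theta> + (2 * pi) *\<^sub>R rvec d)) = cis (rvec (e i) \<bullet> \<theta>)" for i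
    using cis_multiple_2pi[of "of_int (idot (e i) d)"]
    by (simp add: inner_add_right rvec_inner_rvec mult_ac flip: cis_mult)
  then show ?thesis unfolding pval_def exp_real_add_i by simp
qed

lemma continuous_on_pval [continuous_intros]:
  assumes "continuous_on S f" "continuous_on S g"
  shows "continuous_on S (\<lambda>x. pval (f x) (g x))"
  unfolding pval_def by (intro continuous_intros assms)

text \<open>By periodicity the arguments can be taken from a compact box; projecting along this box
  then shows that the amoeba is closed.\<close>

lemma amoeba_iff_cbox:
  "w \<in> amoeba H \<longleftrightarrow> (\<exists>\<theta>. \<theta> \<in> cbox (0,0) (2*pi,2*pi) \<and> pval w \<theta> = 0)"
proof
  assume "w \<in> amoeba H"
  then obtain \<theta> where \<theta>: "pval w \<theta> = 0" using amoeba_iff by blast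
  define k where "k x = \<lfloor>x / (2*pi)\<rfloor>" for x
  have k: "0 \<le> x + 2 * pi * real_of_int (- k x)" "x + 2 * pi * real_of_int (- k x) \<le> 2 * pi" for x
  proof -
    have "real_of_int (k x) \<le> x / (2*pi)" "x / (2*pi) < real_of_int (k x) + 1"
      unfolding k_def by linarith+
    then show "0 \<le> x + 2 * pi * real_of_int (- k x)" "x + 2 * pi * real_of_int (- k x) \<le> 2 * pi"
      by (simp_all add: field_simps)
  qed
  let ?\<theta> = "\<theta> + (2*pi) *\<^sub>R rvec (- k (fst \<theta>), - k (snd \<theta>))"
  have "?\<theta> \<in> cbox (0,0) (2*pi,2*pi)"
    using k[of "fst \<theta>"] k[of "snd \<theta>"] by (cases \<theta>) (simp add: rvec_def)
  with \<theta> pval_periodic show "\<exists>\<theta>. \<theta> \<in> cbox (0,0) (2*pi,2*pi) \<and> pval w \<theta> = 0"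
    by metis
qed (use amoeba_iff in blast)

lemma open_amoeba_complement: "open (UNIV - amoeba H)"
proof -
  have "closed {w. \<exists>\<theta>. \<theta> \<in> cbox (0,0) (2*pi,2*pi) \<and> (\<theta>, w) \<in> (\<lambda>x. pval (snd x) (fst x)) -` {0}}"
    by (intro closed_compact_projection compact_cbox closed_vimage continuous_intros)
  moreover have "{w. \<exists>\<theta>. \<theta> \<in> cbox (0,0) (2*pi,2*pi) \<and> (\<theta>, w) \<in> (\<lambda>x. pval (snd x) (fst x)) -` {0}} = amoeba H"
    using amoeba_iff_cbox by auto
  ultimately show ?thesis by (simp add: open_closed Compl_eq_Diff_UNIV[symmetric])
qed

text \<open>The order through a logarithm on the universal cover of the torus: \<open>n\<close>
  records its periods along the two coordinate circles. Being off the amoeba is part of the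
  relation, since an exponential never vanishes.\<close>

definition has_order :: "real \<times> real \<Rightarrow> int \<times> int \<Rightarrow> bool" where
  "has_order w n \<longleftrightarrow> (\<exists>g. continuous_on UNIV g \<and> (\<forall>\<theta>. pval w \<theta> = exp (g \<theta>)) \<and>
     (\<forall>\<theta>. g (\<theta> + (2*pi) *\<^sub>R rvec (1,0)) = g \<theta> + 2 * pi * real_of_int (fst n) * \<i>) \<and>
     (\<forall>\<theta>. g (\<theta> + (2*pi) *\<^sub>R rvec (0,1)) = g \<theta> + 2 * pi * real_of_int (snd n) * \<i>))"

lemma has_order_not_amoeba: "has_order w n \<Longrightarrow> w \<notin> amoeba H"
  unfolding has_order_def amoeba_iff by force

text \<open>The product of \<open>B\<close> with the plane of arguments is contractible, so one
  logarithm serves all \<open>w\<close> in \<open>B\<close>. Its periods are integers depending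
  continuously on a connected set, hence common to \<open>B\<close>. Singletons give existence of
  the order, balls its local constancy.\<close>

lemma convex_has_order:
  assumes "convex B" "B \<inter> amoeba H = {}"
  shows "\<exists>n. \<forall>w\<in>B. has_order w n"
proof -
  have conv: "convex (B \<times> (UNIV :: (real \<times> real) set))"
    using assms(1) by (intro convex_Times convex_UNIV)
  obtain G where G: "continuous_on (B \<times> UNIV) G"
    "\<And>x. x \<in> B \<times> UNIV \<Longrightarrow> pval (fst x) (snd x) = exp (G x)"
  proof (rule continuous_logarithm_on_contractible[of "B \<times> (UNIV :: (real \<times> real) set)"
        "\<lambda>x. pval (fst x) (snd x)"])
    show "contractible (B \<times> (UNIV :: (real \<times> real) set))"
      by (rule convex_imp_contractible[OF conv])
    show "continuous_on (B \<times> UNIV) (\<lambda>x. pval (fst x) (snd x))"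
      by (intro continuous_intros)
    show "pval (fst z) (snd z) \<noteq> 0" if "z \<in> B \<times> UNIV" for z
      using assms(2) that amoeba_iff[of "fst z"] by force
  qed auto
  have "\<exists>n::int. \<forall>x\<in>B \<times> UNIV. (\<lambda>x. G (fst x, snd x + (2*pi) *\<^sub>R rvec d)) x = G x + 2 * pi * n * \<i>" for d
  proof (rule continuous_logs_differ_by_period)
    show "connected (B \<times> (UNIV :: (real \<times> real) set))"
      using conv by (rule convex_connected)
    show "continuous_on (B \<times> UNIV) (\<lambda>x. G (fst x, snd x + (2*pi) *\<^sub>R rvec d))"
      by (intro continuous_on_compose2[OF G(1)] continuous_intros) auto
    show "exp (G (fst x, snd x + (2*pi) *\<^sub>R rvec d)) = exp (G x)" if "x \<in> B \<times> UNIV" for x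
      using that G(2)[of "(fst x, snd x + (2*pi) *\<^sub>R rvec d)"] G(2)[of x] pval_periodic by auto
  qed (rule G(1))
  then obtain n where n: "\<And>d w \<theta>. w \<in> B \<Longrightarrow> G (w, \<theta> + (2*pi) *\<^sub>R rvec d) = G (w,\<theta>) + 2 * pi * of_int (n d) * \<i>"
    using choice[of "\<lambda>d n. \<forall>x\<in>B \<times> UNIV. G (fst x, snd x + (2*pi) *\<^sub>R rvec d) = G x + 2 * pi * of_int n * \<i>"]
    by auto
  have "has_order w (n (1,0), n (0,1))" if "w \<in> B" for w
    unfolding has_order_def
  proof (intro exI[of _ "\<lambda>\<theta>. G (w, \<theta>)"] conjI allI)
    show "continuous_on UNIV (\<lambda>\<theta>. G (w, \<theta>))"
      using that by (intro continuous_on_compose2[OF G(1)] continuous_intros) auto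
    show "pval w \<theta> = exp (G (w, \<theta>))" for \<theta>
      using G(2)[of "(w,\<theta>)"] that by simp
  qed (use n that in auto)
  then show ?thesis by blast
qed

lemma has_order_exists: "w \<notin> amoeba H \<Longrightarrow> \<exists>n. has_order w n"
  using convex_has_order[of "{w}"] by auto

lemma has_order_loop_index:
  assumes "has_order w n"
  shows "loop_index (\<lambda>t. pval w (\<theta> + t *\<^sub>R rvec d)) (idot n d)"
proof -
  obtain g where g: "continuous_on UNIV g" "\<And>\<theta>. pval w \<theta> = exp (g \<theta>)"
     "\<And>\<theta>. g (\<theta> + (2*pi) *\<^sub>R rvec (1,0)) = g \<theta> + 2 * pi * real_of_int (fst n) * \<i>"
     "\<And>\<theta>. g (\<theta> + (2*pi) *\<^sub>R rvec (0,1)) = g \<theta> + 2 * pi * real_of_int (snd n) * \<i>"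
    using assms unfolding has_order_def by blast
  \<comment> \<open>A period is given for one positive turn only; induction in both directions over
    the integers extends it to all multiples.\<close>
  have 1: "g (\<theta> + (2*pi) *\<^sub>R rvec (k,0)) = g \<theta> + 2 * pi * of_int (k * fst n) * \<i>" for \<theta> k
  proof (induction k rule: int_induct[where k = 0])
    case (step1 i)
    have "\<theta> + (2*pi) *\<^sub>R rvec (i+1,0) = (\<theta> + (2*pi) *\<^sub>R rvec (i,0)) + (2*pi) *\<^sub>R rvec (1,0)"
      by (simp add: rvec_def algebra_simps prod_eq_iff)
    then have "g (\<theta> + (2*pi) *\<^sub>R rvec (i+1,0)) = g (\<theta> + (2*pi) *\<^sub>R rvec (i,0)) + 2 * pi * real_of_int (fst n) * \<i>"
      by (simp only: g(3))
    then show ?case unfolding step1(2) by (simp add: algebra_simps)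
  next
    case (step2 i)
    have "\<theta> + (2*pi) *\<^sub>R rvec (i,0) = (\<theta> + (2*pi) *\<^sub>R rvec (i-1,0)) + (2*pi) *\<^sub>R rvec (1,0)"
      by (simp add: rvec_def algebra_simps prod_eq_iff)
    then have "g (\<theta> + (2*pi) *\<^sub>R rvec (i,0)) = g (\<theta> + (2*pi) *\<^sub>R rvec (i-1,0)) + 2 * pi * real_of_int (fst n) * \<i>"
      by (simp only: g(3))
    then show ?case unfolding step2(2) by (simp add: algebra_simps)
  qed (simp add: rvec_def flip: zero_prod_def)
  have 2: "g (\<theta> + (2*pi) *\<^sub>R rvec (0,k)) = g \<theta> + 2 * pi * of_int (k * snd n) * \<i>" for \<theta> k
  proof (induction k rule: int_induct[where k = 0])
    case (step1 i)
    have "\<theta> + (2*pi) *\<^sub>R rvec (0,i+1) = (\<theta> + (2*pi) *\<^sub>R rvec (0,i)) + (2*pi) *\<^sub>R rvec (0,1)"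
      by (simp add: rvec_def algebra_simps prod_eq_iff)
    then have "g (\<theta> + (2*pi) *\<^sub>R rvec (0,i+1)) = g (\<theta> + (2*pi) *\<^sub>R rvec (0,i)) + 2 * pi * real_of_int (snd n) * \<i>"
      by (simp only: g(4))
    then show ?case unfolding step1(2) by (simp add: algebra_simps)
  next
    case (step2 i)
    have "\<theta> + (2*pi) *\<^sub>R rvec (0,i) = (\<theta> + (2*pi) *\<^sub>R rvec (0,i-1)) + (2*pi) *\<^sub>R rvec (0,1)"
      by (simp add: rvec_def algebra_simps prod_eq_iff)
    then have "g (\<theta> + (2*pi) *\<^sub>R rvec (0,i)) = g (\<theta> + (2*pi) *\<^sub>R rvec (0,i-1)) + 2 * pi * real_of_int (snd n) * \<i>"
      by (simp only: g(4))
    then show ?case unfolding step2(2) by (simp add: algebra_simps)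
  qed (simp add: rvec_def flip: zero_prod_def)
  have split: "\<theta> + (2*pi) *\<^sub>R rvec d = (\<theta> + (2*pi) *\<^sub>R rvec (fst d,0)) + (2*pi) *\<^sub>R rvec (0,snd d)"
    by (simp add: rvec_def algebra_simps prod_eq_iff)
  have "g (\<theta> + (2*pi) *\<^sub>R rvec d) = g \<theta> + 2 * pi * of_int (idot n d) * \<i>"
    unfolding split 2 1 by (simp add: idot_def algebra_simps)
  then show ?thesis
    unfolding loop_index_def
    by (intro exI[of _ "\<lambda>t. g (\<theta> + t *\<^sub>R rvec d)"] conjI continuous_on_compose2[OF g(1)] continuous_intros)
       (auto simp: g(2))
qed

section \<open>Restriction to integer directions and counting of zeros\<close>

text \<open>With \<open>z = exp s * cis t\<close>, moving by \<open>s\<close> and \<open>t\<close>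
  along \<open>d\<close> multiplies the \<open>i\<close>-th monomial by
  \<open>z powi idot (e i) d\<close>. The factor \<open>z ^ N\<close> clears negative exponents, and
  the degree bound records the largest exponent of the direction.\<close>

lemma line_poly:
  assumes "I \<noteq> {}"
  shows "\<exists>P N. (\<forall>s t. poly P (of_real (exp s) * cis t) =
              (of_real (exp s) * cis t) ^ N * pval (w + s *\<^sub>R rvec d) (\<theta> + t *\<^sub>R rvec d)) \<and>
           (\<exists>i\<in>I. int (degree P) \<le> int N + idot (e i) d)"
proof -
  define N where "N = nat (Max ((\<lambda>i. \<bar>idot (e i) d\<bar>) ` I))"
  have N: "int N + idot (e i) d \<ge> 0" if "i \<in> I" for i
  proof -
    have "\<bar>idot (e i) d\<bar> \<le> Max ((\<lambda>i. \<bar>idot (e i) d\<bar>) ` I)"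
      using finite_I that by (intro Max_ge) auto
    then show ?thesis unfolding N_def by linarith
  qed
  define c where "c i = a i * exp (of_real (rvec (e i) \<bullet> w) + \<i> * of_real (rvec (e i) \<bullet> \<theta>))" for i
  define P where "P = (\<Sum>i\<in>I. monom (c i) (nat (int N + idot (e i) d)))"
  have "poly P (of_real (exp s) * cis t) =
              (of_real (exp s) * cis t) ^ N * pval (w + s *\<^sub>R rvec d) (\<theta> + t *\<^sub>R rvec d)" for s t
  proof -
    let ?T = "exp (Complex s t)"
    have T: "of_real (exp s) * cis t = ?T"
      by (simp add: Complex_eq exp_real_add_i)
    have "c i * ?T ^ nat (int N + idot (e i) d) =
      ?T ^ N * (a i * exp (of_real (rvec (e i) \<bullet> (w + s *\<^sub>R rvec d)) + \<i> * of_real (rvec (e i) \<bullet> (\<theta> + t *\<^sub>R rvec d))))"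
      if "i \<in> I" for i
    proof -
      have "?T ^ nat (int N + idot (e i) d) = ?T powi (int N + idot (e i) d)"
        using N[OF that] by (simp add: power_int_def)
      also have "\<dots> = ?T ^ N * ?T powi (idot (e i) d)"
        by (subst power_int_add) auto
      also have "?T powi (idot (e i) d) = exp (of_int (idot (e i) d) * Complex s t)"
        by (rule exp_power_int)
      finally show ?thesis
        by (simp add: c_def rvec_inner_rvec inner_add_right Complex_eq algebra_simps flip: exp_add)
    qed
    then show ?thesis
      unfolding T P_def pval_def by (simp add: poly_sum poly_monom sum_distrib_left)
  qed
  moreover have "\<exists>i\<in>I. int (degree P) \<le> int N + idot (e i) d"
  proof -
    have "Max ((\<lambda>i. idot (e i) d) ` I) \<in> (\<lambda>i. idot (e i) d) ` I"
      using finite_I assms by (intro Max_in) auto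
    then obtain i where i: "i \<in> I" "Max ((\<lambda>i. idot (e i) d) ` I) = idot (e i) d" by auto
    have "degree P \<le> nat (int N + idot (e i) d)"
      unfolding P_def
    proof (rule degree_sum_le[OF finite_I])
      fix j assume "j \<in> I"
      then have "idot (e j) d \<le> idot (e i) d"
        unfolding i(2)[symmetric] using finite_I by (intro Max_ge) auto
      then show "degree (monom (c j) (nat (int N + idot (e j) d))) \<le> nat (int N + idot (e i) d)"
        by (intro order_trans[OF degree_monom_le]) auto
    qed
    with N[OF i(1)] i(1) show ?thesis by (intro bexI[of _ i]) auto
  qed
  ultimately show ?thesis by blast
qed

lemma nonempty_if_has_order: "has_order w n \<Longrightarrow> I \<noteq> {}"
  unfolding has_order_def pval_def by auto

text \<open>The winding number of \<open>P\<close> on the circle of radius \<open>exp s\<close> is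
  computed twice: from the zeros inside, and from the order. \<open>P\<close> and \<open>N\<close>
  depend on \<open>w\<close>, \<open>d\<close>, \<open>\<theta>\<close> but not on \<open>s\<close>,
  so counts at different points of the line can be compared.\<close>

lemma root_count:
  assumes "I \<noteq> {}"
  obtains P :: "complex poly" and N :: nat where
    "\<And>s. (\<exists>t. poly P (of_real (exp s) * cis t) = 0) \<longleftrightarrow> (\<exists>t. pval (w + s *\<^sub>R rvec d) (\<theta> + t *\<^sub>R rvec d) = 0)"
    "\<And>s n. has_order (w + s *\<^sub>R rvec d) n \<Longrightarrow>
       idot n d + int N = int (size (filter_mset (\<lambda>z. cmod z < exp s) (proots P)))"
    "\<exists>i\<in>I. int (degree P) \<le> int N + idot (e i) d"
proof -
  obtain P N where P: "\<And>s t. poly P (of_real (exp s) * cis t) =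
              (of_real (exp s) * cis t) ^ N * pval (w + s *\<^sub>R rvec d) (\<theta> + t *\<^sub>R rvec d)"
    "\<exists>i\<in>I. int (degree P) \<le> int N + idot (e i) d"
    using line_poly[OF assms] by metis
  have iff: "(\<exists>t. poly P (of_real (exp s) * cis t) = 0) \<longleftrightarrow> (\<exists>t. pval (w + s *\<^sub>R rvec d) (\<theta> + t *\<^sub>R rvec d) = 0)" for s
    unfolding P(1) by simp
  have "idot n d + int N = int (size (filter_mset (\<lambda>z. cmod z < exp s) (proots P)))"
    if n: "has_order (w + s *\<^sub>R rvec d) n" for s n
  proof (rule loop_index_unique)
    have "cmod z \<noteq> exp s" if "poly P z = 0" for z
    proof
      assume "cmod z = exp s"
      then have "z = of_real (exp s) * cis (Arg z)"
        by (metis rcis_cmod_Arg rcis_def)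
      with that have "\<exists>t. poly P (of_real (exp s) * cis t) = 0" by metis
      with iff amoeba_iff has_order_not_amoeba[OF n] show False by blast
    qed
    then show "loop_index (\<lambda>t. poly P (of_real (exp s) * cis t))
        (int (size (filter_mset (\<lambda>z. cmod z < exp s) (proots P))))"
      by (intro loop_index_poly) auto
    have *: "loop_index (\<lambda>t. (of_real (exp s) * cis t) ^ m) (int m)" for m
    proof -
      have "loop_index (\<lambda>t. of_real (exp s) ^ m * cis (real_of_int (int m) * t)) (0 + int m)"
        by (intro loop_index_mult loop_index_const loop_index_cis_multiple) simp
      then show ?thesis by (simp add: power_mult_distrib Complex.DeMoivre)
    qed
    show "loop_index (\<lambda>t. poly P (of_real (exp s) * cis t)) (idot n d + int N)"
      unfolding P(1) using loop_index_mult[OF * has_order_loop_index[OF n]] by (simp add: add.commute)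
  qed
  with iff P(2) that show ?thesis by blast
qed

lemma size_filter_mset_mono:
  assumes "\<And>x. x \<in># A \<Longrightarrow> Q x \<Longrightarrow> R x"
  shows "size (filter_mset Q A) \<le> size (filter_mset R A)"
  using assms by (intro size_mset_mono filter_mset_mono_strong) auto

text \<open>A larger disc contains at least as many zeros. The case \<open>s = 0\<close>, used in
  both directions, yields uniqueness of the order.\<close>

lemma order_mono:
  assumes "has_order w n" "has_order (w + s *\<^sub>R rvec d) n'" "s \<ge> 0"
  shows "idot n d \<le> idot n' d"
proof -
  obtain P N where P: "\<And>s n. has_order (w + s *\<^sub>R rvec d) n \<Longrightarrow>
       idot n d + int N = int (size (filter_mset (\<lambda>z. cmod z < exp s) (proots P)))"
    using root_count[OF nonempty_if_has_order[OF assms(1)], of w d 0] by metis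
  have "size (filter_mset (\<lambda>z. cmod z < exp 0) (proots P)) \<le> size (filter_mset (\<lambda>z. cmod z < exp s) (proots P))"
  proof (rule size_filter_mset_mono)
    fix x :: complex assume "cmod x < exp 0"
    also have "exp 0 \<le> exp s" using assms(3) by simp
    finally show "cmod x < exp s" .
  qed
  with P[of 0 n] P[of s n'] assms show ?thesis by simp
qed

lemma order_unique:
  assumes "has_order w n" "has_order w n'"
  shows "n = n'"
proof -
  have "idot n d = idot n' d" for d
    using order_mono[of w n 0 d n'] order_mono[of w n' 0 d n] assms by simp
  from this[of "(1,0)"] this[of "(0,1)"] show ?thesis
    by (simp add: idot_def prod_eq_iff)
qed

text \<open>The zeros in the disc are at most \<open>degree P\<close> many, and the shift by
  \<open>N\<close> cancels.\<close>

lemma order_le_exponent: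
  assumes "has_order w n"
  shows "\<exists>i\<in>I. idot n d \<le> idot (e i) d"
proof -
  obtain P N where P: "\<And>s n. has_order (w + s *\<^sub>R rvec d) n \<Longrightarrow>
       idot n d + int N = int (size (filter_mset (\<lambda>z. cmod z < exp s) (proots P)))"
    "\<exists>i\<in>I. int (degree P) \<le> int N + idot (e i) d"
    using root_count[OF nonempty_if_has_order[OF assms(1)], of w d 0] by metis
  have "size (filter_mset (\<lambda>z. cmod z < exp 0) (proots P)) \<le> degree P"
    using size_mset_mono[OF multiset_filter_subset] size_proots_complex by metis
  moreover obtain i where "i \<in> I" "int (degree P) \<le> int N + idot (e i) d" using P(2) by blast
  ultimately show ?thesis using P(1)[of 0 n] assms by (intro bexI[of _ i]) auto
qed

text \<open>Equal orders at the ends give equal zero counts for the two discs, whereas an amoeba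
  point in between would be a zero in the larger disc but not in the smaller one.\<close>

lemma segment_disjoint_amoeba:
  assumes "has_order w n" "has_order (w + s *\<^sub>R rvec d) n" "0 \<le> \<sigma>" "\<sigma> \<le> s"
  shows "w + \<sigma> *\<^sub>R rvec d \<notin> amoeba H"
proof
  assume "w + \<sigma> *\<^sub>R rvec d \<in> amoeba H"
  then obtain \<theta> where \<theta>: "pval (w + \<sigma> *\<^sub>R rvec d) \<theta> = 0" using amoeba_iff by blast
  \<comment> \<open>The base argument is that of the supposed zero, so that the complexified line
    through it meets the zero at \<open>s = \<sigma>\<close>, \<open>t = 0\<close>.\<close>
  obtain P N where P:
    "\<And>s. (\<exists>t. poly P (of_real (exp s) * cis t) = 0) \<longleftrightarrow> (\<exists>t. pval (w + s *\<^sub>R rvec d) (\<theta> + t *\<^sub>R rvec d) = 0)"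
    "\<And>s n. has_order (w + s *\<^sub>R rvec d) n \<Longrightarrow>
       idot n d + int N = int (size (filter_mset (\<lambda>z. cmod z < exp s) (proots P)))"
    using root_count[OF nonempty_if_has_order[OF assms(1)], of w d \<theta>] by metis
  have "pval (w + \<sigma> *\<^sub>R rvec d) (\<theta> + 0 *\<^sub>R rvec d) = 0" using \<theta> by simp
  then obtain t where t: "poly P (of_real (exp \<sigma>) * cis t) = 0"
    using P(1) by blast
  have "pval w \<theta> \<noteq> 0" for \<theta>
    using has_order_not_amoeba[OF assms(1)] amoeba_iff by blast
  then have "P \<noteq> 0"
    using P(1)[of 0] by auto
  define z where "z = complex_of_real (exp \<sigma>) * cis t"
  have z: "z \<in># proots P" "cmod z = exp \<sigma>"
    using t \<open>P \<noteq> 0\<close> by (auto simp: z_def norm_mult)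
  have "\<sigma> \<noteq> s" using \<theta> assms(2) has_order_not_amoeba amoeba_iff by blast
  then have "\<sigma> < s" using assms by simp
  let ?A = "filter_mset (\<lambda>z. cmod z < exp 0) (proots P)"
  let ?B = "filter_mset (\<lambda>z. cmod z < exp s) (proots P)"
  have "?A \<subseteq># ?B"
    using assms by (intro filter_mset_mono_strong) (auto intro: less_le_trans)
  moreover have "size ?A = size ?B"
    using P(2)[of 0 n] P(2)[of s n] assms by simp
  ultimately have "?A = ?B"
    by (metis mset_subset_size nless_le subset_mset.le_imp_less_or_eq)
  moreover have "z \<in># ?B" "z \<notin># ?A" using z \<open>\<sigma> < s\<close> assms(3) by auto
  ultimately show False by simp
qed

text \<open>A direction separating \<open>rvec n\<close> strictly from all exponents can be moved
  slightly to a rational one and scaled to an integer one, against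
  \<open>order_le_exponent\<close>.\<close>

lemma order_in_hull:
  assumes "has_order w n"
  shows "rvec n \<in> convex hull (\<lambda>i. rvec (e i)) ` I"
proof (rule ccontr)
  assume *: "rvec n \<notin> convex hull (\<lambda>i. rvec (e i)) ` I"
  have "closed (convex hull (\<lambda>i. rvec (e i)) ` I)"
    using finite_I by (intro compact_imp_closed finite_imp_compact_convex_hull) auto
  then obtain v b where v: "v \<bullet> rvec n < b" "\<And>x. x \<in> convex hull (\<lambda>i. rvec (e i)) ` I \<Longrightarrow> b < v \<bullet> x"
    using separating_hyperplane_closed_point[OF convex_convex_hull _ *] by blast
  \<comment> \<open>The strictly separating directions form a finite intersection of open
    half-spaces; the separating normal enters with reversed sign.\<close>
  define U where "U = (\<Inter>i\<in>I. {x. (rvec n - rvec (e i)) \<bullet> x > 0})"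
  have "open U" unfolding U_def
    using finite_I by (intro open_INT ballI open_halfspace_gt)
  moreover have "- v \<in> U"
  proof -
    have "v \<bullet> rvec n < v \<bullet> rvec (e i)" if "i \<in> I" for i
      using v(1) v(2)[OF hull_inc, of "rvec (e i)"] that by force
    then show ?thesis by (simp add: U_def inner_diff inner_commute)
  qed
  ultimately obtain d :: "int \<times> int" and N :: nat where N: "N > 0"
    "(1 / real N) *\<^sub>R (real_of_int (fst d), real_of_int (snd d)) \<in> U"
    using open_contains_rational_point by blast
  then have U: "(1 / real N) *\<^sub>R rvec d \<in> U" by (simp add: rvec_def)
  obtain i where i: "i \<in> I" "idot n d \<le> idot (e i) d" using order_le_exponent[OF assms] by blast
  have "(rvec n - rvec (e i)) \<bullet> ((1 / real N) *\<^sub>R rvec d) > 0"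
    using U i(1) unfolding U_def by blast
  then have "(rvec n - rvec (e i)) \<bullet> rvec d > 0"
    using N(1) by (simp add: zero_less_divide_iff)
  then have "idot n d > idot (e i) d"
    by (simp add: inner_diff_left rvec_inner_rvec)
  with i show False by simp
qed

end

section \<open>The Ronkin function\<close>

lemma ln_cmod_has_field_derivative:
  assumes "(f has_vector_derivative f') (at t within S)" "f t \<noteq> 0"
  shows "((\<lambda>t. ln (cmod (f t))) has_field_derivative Re (f' / f t)) (at t within S)"
proof -
  \<comment> \<open>The squared modulus avoids differentiating a square root. The identity also
    holds at \<open>z = 0\<close>, by the convention \<open>ln 0 = 0\<close>, so both sides are the
    same function.\<close>
  have eq: "ln (cmod z) = ln ((Re z)\<^sup>2 + (Im z)\<^sup>2) / 2" for z
    by (cases "z = 0") (auto simp: cmod_def ln_sqrt complex_eq_iff sum_power2_gt_zero_iff)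
  have pos: "(Re (f t))\<^sup>2 + (Im (f t))\<^sup>2 > 0"
    using assms(2) by (simp add: sum_power2_gt_zero_iff complex_eq_iff)
  have half: "(2 * x + 2 * y) / D / 2 = (x + y) / D" for x y D :: real
    by (cases "D = 0") (auto simp: field_simps)
  have "((\<lambda>t. ln ((Re (f t))\<^sup>2 + (Im (f t))\<^sup>2) / 2) has_field_derivative
     (2 * (Re f' * Re (f t)) + 2 * (Im f' * Im (f t))) / ((Re (f t))\<^sup>2 + (Im (f t))\<^sup>2) / 2) (at t within S)"
    using pos assms(1) by (auto intro!: derivative_eq_intros simp: field_simps)
  then have "((\<lambda>t. ln ((Re (f t))\<^sup>2 + (Im (f t))\<^sup>2) / 2) has_field_derivative Re (f' / f t)) (at t within S)"
    unfolding half Re_divide .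
  then show ?thesis unfolding eq .
qed

text \<open>Near \<open>t\<close> continuity keeps the imaginary part of \<open>g x - g t\<close>
  below \<pi>, so this difference is the principal logarithm of \<open>f x / f t\<close>, which is
  differentiable at 1.\<close>

lemma continuous_log_has_vector_derivative:
  fixes f g :: "real \<Rightarrow> complex"
  assumes g: "continuous_on S g" "\<And>t. t \<in> S \<Longrightarrow> f t = exp (g t)"
    and f: "(f has_vector_derivative f') (at t within S)" and t: "t \<in> S"
  shows "(g has_vector_derivative f' / f t) (at t within S)"
proof -
  obtain d where d: "d > 0" "\<And>x. x \<in> S \<Longrightarrow> dist x t < d \<Longrightarrow> dist (g x) (g t) < 1"
    using g(1) t unfolding continuous_on_iff by (metis zero_less_one)
  have nz: "f t \<noteq> 0" using g(2) t by simp
  have "((\<lambda>x. f x / f t) has_vector_derivative f' / f t) (at t within S)"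
    by (rule bounded_linear.has_vector_derivative[OF bounded_linear_divide f])
  moreover have "(Ln has_field_derivative 1) (at (f t / f t) within (\<lambda>x. f x / f t) ` S)"
    using nz by (auto intro!: derivative_eq_intros)
  ultimately have "((Ln \<circ> (\<lambda>x. f x / f t)) has_vector_derivative (f' / f t) * 1) (at t within S)"
    by (rule field_vector_diff_chain_within)
  then have "((\<lambda>x. g t + (Ln \<circ> (\<lambda>x. f x / f t)) x) has_vector_derivative f' / f t) (at t within S)"
    by (auto intro!: derivative_eq_intros simp: o_def)
  then show ?thesis
  proof (rule has_vector_derivative_transform_within[OF _ d(1) t])
    fix x assume x: "x \<in> S" "dist x t < d"
    have "\<bar>Im (g x - g t)\<bar> < 1"
      using d(2)[OF x] abs_Im_le_cmod[of "g x - g t"] by (simp add: dist_norm)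
    then have "Ln (exp (g x - g t)) = g x - g t"
      using pi_gt3 by (intro Ln_exp) auto
    then show "g t + (Ln \<circ> (\<lambda>x. f x / f t)) x = g x"
      using x t g(2) by (simp add: exp_diff)
  qed
qed

lemma logarithmic_derivative_has_integral:
  fixes f f' g :: "real \<Rightarrow> complex"
  assumes "continuous_on {a..b} g" "\<And>t. t \<in> {a..b} \<Longrightarrow> f t = exp (g t)" "a \<le> b"
    and "\<And>t. t \<in> {a..b} \<Longrightarrow> (f has_vector_derivative f' t) (at t within {a..b})"
  shows "((\<lambda>t. f' t / f t) has_integral g b - g a) {a..b}"
  using assms by (intro fundamental_theorem_of_calculus continuous_log_has_vector_derivative) auto

lemma exp_line_has_vector_derivative:
  fixes A B :: complex
  shows "((\<lambda>t. exp (A + of_real t * B)) has_vector_derivative B * exp (A + of_real t * B)) (at t within S)"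
proof (rule has_vector_derivative_real_field[where f = "\<lambda>z. exp (A + z * B)"])
  show "((\<lambda>z. exp (A + z * B)) has_field_derivative B * exp (A + of_real t * B)) (at (of_real t))"
    by (auto intro!: derivative_eq_intros)
qed

section \<open>Torus integrals and the gradient of the Ronkin function\<close>

context laurent
begin

text \<open>The logarithmic derivative operator \<open>v1 * X * d/dX + v2 * Y * d/dY\<close> applied
  to the polynomial. It is the derivative of \<open>pval\<close> in \<open>w\<close> along
  \<open>v\<close>; the derivative in \<open>\<theta>\<close> is \<i> times it.\<close>

definition dval :: "real \<times> real \<Rightarrow> real \<times> real \<Rightarrow> real \<times> real \<Rightarrow> complex" where
  "dval v w \<theta> = (\<Sum>i\<in>I. of_real (rvec (e i) \<bullet> v) * (a i * exp (of_real (rvec (e i) \<bullet> w) + \<i> * of_real (rvec (e i) \<bullet> \<theta>))))"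

lemma continuous_on_dval [continuous_intros]:
  assumes "continuous_on S f" "continuous_on S g"
  shows "continuous_on S (\<lambda>x. dval v (f x) (g x))"
  unfolding dval_def by (intro continuous_intros assms)

lemma pval_deriv_modulus:
  "((\<lambda>s. pval (w + s *\<^sub>R v) \<theta>) has_vector_derivative dval v (w + s *\<^sub>R v) \<theta>) (at s within S)"
  unfolding pval_def dval_def
proof (rule has_vector_derivative_sum)
  fix i
  show "((\<lambda>s. a i * exp (of_real (rvec (e i) \<bullet> (w + s *\<^sub>R v)) + \<i> * of_real (rvec (e i) \<bullet> \<theta>))) has_vector_derivative
      of_real (rvec (e i) \<bullet> v) * (a i * exp (of_real (rvec (e i) \<bullet> (w + s *\<^sub>R v)) + \<i> * of_real (rvec (e i) \<bullet> \<theta>)))) (at s within S)"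
    using has_vector_derivative_mult_right[OF exp_line_has_vector_derivative[of
        "of_real (rvec (e i) \<bullet> w) + \<i> * of_real (rvec (e i) \<bullet> \<theta>)" "of_real (rvec (e i) \<bullet> v)" s S], of "a i"]
    by (simp add: inner_add_right add_ac mult_ac)
qed

lemma pval_deriv_argument:
  "((\<lambda>t. pval w (\<theta> + t *\<^sub>R v)) has_vector_derivative \<i> * dval v w (\<theta> + t *\<^sub>R v)) (at t within S)"
  unfolding pval_def dval_def sum_distrib_left
proof (rule has_vector_derivative_sum)
  fix i
  show "((\<lambda>t. a i * exp (of_real (rvec (e i) \<bullet> w) + \<i> * of_real (rvec (e i) \<bullet> (\<theta> + t *\<^sub>R v)))) has_vector_derivative
      \<i> * (of_real (rvec (e i) \<bullet> v) * (a i * exp (of_real (rvec (e i) \<bullet> w) + \<i> * of_real (rvec (e i) \<bullet> (\<theta> + t *\<^sub>R v)))))) (at t within S)"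
    using has_vector_derivative_mult_right[OF exp_line_has_vector_derivative[of
        "of_real (rvec (e i) \<bullet> w) + \<i> * of_real (rvec (e i) \<bullet> \<theta>)" "\<i> * of_real (rvec (e i) \<bullet> v)" t S], of "a i"]
    by (simp add: inner_add_right distrib_left add_ac mult_ac)
qed

lemma dval_split: "dval v w \<theta> = of_real (fst v) * dval (1,0) w \<theta> + of_real (snd v) * dval (0,1) w \<theta>"
  unfolding dval_def sum_distrib_left sum.distrib[symmetric]
  by (intro sum.cong refl) (simp add: inner_prod_def algebra_simps)

definition torus_integral :: "real \<times> real \<Rightarrow> real" where
  "torus_integral w = integral (cbox (0,0) (2*pi,2*pi)) (\<lambda>\<theta>. ln (cmod (pval w \<theta>)))"

text \<open>Off the amoeba the integrand is continuous, so the iterated Lebesgue integrals agree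
  with the integral over the box.\<close>

lemma ronkin_eq_torus_integral:
  assumes "w \<notin> amoeba H"
  shows "ronkin H w = torus_integral w / (2*pi)^2"
proof -
  have nz: "pval w \<theta> \<noteq> 0" for \<theta> using assms amoeba_iff by blast
  let ?f = "\<lambda>t1 t2. ln (cmod (pval w (t1,t2)))"
  have cont: "continuous_on S (\<lambda>(t1,t2). ?f t1 t2)" for S
    unfolding case_prod_unfold by (intro continuous_intros) (use nz in auto)
  have "continuous_on UNIV (\<lambda>t1. integral (cbox 0 (2*pi)) (?f t1))"
    by (rule integral_continuous_on_param) (rule cont)
  then have outer: "set_integrable lborel {0..2*pi} (\<lambda>t1. integral (cbox 0 (2*pi)) (?f t1))"
    by (intro borel_integrable_atLeastAtMost') (auto intro: continuous_on_subset)
  have inner: "(LINT t2:{0..2*pi}|lborel. ?f t1 t2) = integral (cbox 0 (2*pi)) (?f t1)" for t1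
  proof -
    have "set_integrable lborel {0..2*pi} (?f t1)"
      by (intro borel_integrable_atLeastAtMost' continuous_intros) (use nz in auto)
    then show ?thesis using set_borel_integral_eq_integral(2) by simp
  qed
  have "(LINT t1:{0..2*pi}|lborel. LINT t2:{0..2*pi}|lborel. ?f t1 t2)
     = integral (cbox 0 (2*pi)) (\<lambda>t1. integral (cbox 0 (2*pi)) (?f t1))"
    unfolding inner using set_borel_integral_eq_integral(2)[OF outer] by simp
  also have "\<dots> = torus_integral w"
    using integral_prod_continuous[OF cont, of 0 0 "2*pi" "2*pi"] by (simp add: torus_integral_def case_prod_unfold)
  finally show ?thesis
    unfolding ronkin_def using H_exp[of w "(_,_)"] by simp
qed

text \<open>Along a coordinate circle the integral of
  \<open>dval v w \<theta> / pval w \<theta>\<close> is a period of the logarithm divided by \<i>,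
  the same for every value of the other argument. General \<open>v\<close> follow by
  linearity.\<close>

lemma dval_torus_integral:
  assumes "has_order w n"
  shows "((\<lambda>\<theta>. dval v w \<theta> / pval w \<theta>) has_integral (2*pi)^2 * of_real (rvec n \<bullet> v)) (cbox (0,0) (2*pi,2*pi))"
proof -
  obtain g where g: "continuous_on UNIV g" "\<And>\<theta>. pval w \<theta> = exp (g \<theta>)"
     "\<And>\<theta>. g (\<theta> + (2*pi) *\<^sub>R rvec (1,0)) = g \<theta> + 2 * pi * real_of_int (fst n) * \<i>"
     "\<And>\<theta>. g (\<theta> + (2*pi) *\<^sub>R rvec (0,1)) = g \<theta> + 2 * pi * real_of_int (snd n) * \<i>"
    using assms unfolding has_order_def by blast
  have nz: "pval w \<theta> \<noteq> 0" for \<theta> using g(2) by simp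
  let ?h = "\<lambda>v \<theta>. dval v w \<theta> / pval w \<theta>"
  have cont: "continuous_on S (?h v)" for S v
    by (intro continuous_intros) (use nz in auto)
  have line: "((\<lambda>t. ?h v (\<theta> + t *\<^sub>R v)) has_integral (g (\<theta> + (2*pi) *\<^sub>R v) - g \<theta>) / \<i>) {0..2*pi}" for v \<theta>
  proof -
    have "((\<lambda>t. \<i> * dval v w (\<theta> + t *\<^sub>R v) / pval w (\<theta> + t *\<^sub>R v)) has_integral
        g (\<theta> + (2*pi) *\<^sub>R v) - g (\<theta> + 0 *\<^sub>R v)) {0..2*pi}"
      by (rule logarithmic_derivative_has_integral)
         (auto simp: g(2)[symmetric] intro: pval_deriv_argument
           intro!: continuous_on_compose2[OF g(1)] continuous_intros)
    then have "((\<lambda>t. \<i> * dval v w (\<theta> + t *\<^sub>R v) / pval w (\<theta> + t *\<^sub>R v) / \<i>) has_integral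
        (g (\<theta> + (2*pi) *\<^sub>R v) - g (\<theta> + 0 *\<^sub>R v)) / \<i>) {0..2*pi}"
      by (rule has_integral_divide)
    then show ?thesis by simp
  qed
  have ii: "- (\<i> * (c * \<i>)) = c" for c by (simp add: complex_eq_iff)
  have v1: "integral (cbox (0,0) (2*pi,2*pi)) (?h (1,0)) = complex_of_real ((2*pi)^2 * real_of_int (fst n))"
  proof -
    have "integral {0..2*pi} (\<lambda>x. ?h (1,0) (x,y)) = 2 * pi * of_int (fst n)" for y
      using line[of "rvec (1,0)" "(0,y)"] unfolding g(3) by (intro integral_unique) (simp add: rvec_def ii)
    \<comment> \<open>For the first coordinate the order of integration is swapped, so that the
      inner integral runs over the circle whose period is known.\<close>
    moreover have "integral (cbox (0,0) (2*pi,2*pi)) (?h (1,0))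
      = integral (cbox 0 (2*pi)) (\<lambda>y. integral (cbox 0 (2*pi)) (\<lambda>x. ?h (1,0) (x,y)))"
      using cont by (subst integral_prod_continuous[OF cont], subst integral_swap_continuous)
        (auto simp: case_prod_unfold)
    ultimately show ?thesis by (simp add: power2_eq_square scaleR_conv_of_real)
  qed
  have v2: "integral (cbox (0,0) (2*pi,2*pi)) (?h (0,1)) = complex_of_real ((2*pi)^2 * real_of_int (snd n))"
  proof -
    have "integral {0..2*pi} (\<lambda>y. ?h (0,1) (x,y)) = 2 * pi * of_int (snd n)" for x
      using line[of "rvec (0,1)" "(x,0)"] unfolding g(4) by (intro integral_unique) (simp add: rvec_def ii)
    moreover have "integral (cbox (0,0) (2*pi,2*pi)) (?h (0,1))
      = integral (cbox 0 (2*pi)) (\<lambda>x. integral (cbox 0 (2*pi)) (\<lambda>y. ?h (0,1) (x,y)))"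
      by (subst integral_prod_continuous[OF cont]) auto
    ultimately show ?thesis by (simp add: power2_eq_square scaleR_conv_of_real)
  qed
  have hi: "(?h v has_integral integral (cbox (0,0) (2*pi,2*pi)) (?h v)) (cbox (0,0) (2*pi,2*pi))" for v
    using integrable_continuous[OF cont] by (rule integrable_integral)
  have "((\<lambda>\<theta>. of_real (fst v) * ?h (1,0) \<theta> + of_real (snd v) * ?h (0,1) \<theta>) has_integral
     complex_of_real (fst v) * complex_of_real ((2*pi)^2 * real_of_int (fst n)) + complex_of_real (snd v) * complex_of_real ((2*pi)^2 * real_of_int (snd n))) (cbox (0,0) (2*pi,2*pi))"
    by (intro has_integral_add has_integral_mult_right) (use hi[of "(1,0)"] hi[of "(0,1)"] v1 v2 in auto)
  moreover have "?h v \<theta> = of_real (fst v) * ?h (1,0) \<theta> + of_real (snd v) * ?h (0,1) \<theta>" for \<theta>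
    by (subst dval_split) (simp add: add_divide_distrib)
  moreover have "complex_of_real (fst v) * complex_of_real ((2*pi)^2 * real_of_int (fst n)) + complex_of_real (snd v) * complex_of_real ((2*pi)^2 * real_of_int (snd n))
     = (2*pi)^2 * complex_of_real (rvec n \<bullet> v)"
    by (simp add: rvec_def inner_prod_def algebra_simps)
  ultimately show ?thesis by simp
qed

text \<open>Differentiation under the integral gives the real part of \<open>dval / pval\<close>,
  whose integral depends on the order only and is therefore constant along the segment.\<close>

lemma torus_integral_segment:
  assumes "\<And>s. s \<in> {0..1} \<Longrightarrow> has_order (w + s *\<^sub>R v) n"
  shows "torus_integral (w + v) - torus_integral w = (2*pi)^2 * (rvec n \<bullet> v)"
proof -
  have nz: "pval (w + s *\<^sub>R v) \<theta> \<noteq> 0" if "s \<in> {0..1}" for s \<theta>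
    using has_order_not_amoeba[OF assms[OF that]] amoeba_iff by blast
  have "((\<lambda>s. torus_integral (w + s *\<^sub>R v)) has_vector_derivative (2*pi)^2 * (rvec n \<bullet> v)) (at s within {0..1})"
    if s: "s \<in> {0..1}" for s
  proof -
    have "((\<lambda>s. torus_integral (w + s *\<^sub>R v)) has_vector_derivative
       integral (cbox (0,0) (2*pi,2*pi)) (\<lambda>\<theta>. Re (dval v (w + s *\<^sub>R v) \<theta> / pval (w + s *\<^sub>R v) \<theta>))) (at s within {0..1})"
      unfolding torus_integral_def
    proof (rule leibniz_rule_vector_derivative)
      show "((\<lambda>s. ln (cmod (pval (w + s *\<^sub>R v) \<theta>))) has_vector_derivative
          Re (dval v (w + s *\<^sub>R v) \<theta> / pval (w + s *\<^sub>R v) \<theta>)) (at s within {0..1})" if "s \<in> {0..1}" for s \<theta>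
        using ln_cmod_has_field_derivative[OF pval_deriv_modulus nz[OF that]]
        unfolding has_real_derivative_iff_has_vector_derivative .
      show "(\<lambda>\<theta>. ln (cmod (pval (w + s *\<^sub>R v) \<theta>))) integrable_on cbox (0, 0) (2 * pi, 2 * pi)"
        if "s \<in> {0..1}" for s
        by (intro integrable_continuous continuous_intros) (use nz[OF that] in auto)
      show "continuous_on ({0..1} \<times> cbox (0, 0) (2 * pi, 2 * pi))
          (\<lambda>(s, \<theta>). Re (dval v (w + s *\<^sub>R v) \<theta> / pval (w + s *\<^sub>R v) \<theta>))"
        unfolding case_prod_unfold by (intro continuous_intros) (use nz in auto)
    qed (use s in auto)
    moreover have "((\<lambda>\<theta>. Re (dval v (w + s *\<^sub>R v) \<theta> / pval (w + s *\<^sub>R v) \<theta>)) has_integral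
        Re ((2*pi)^2 * of_real (rvec n \<bullet> v))) (cbox (0,0) (2*pi,2*pi))"
      using has_integral_linear[OF dval_torus_integral[OF assms[OF s]] bounded_linear_Re]
      by (simp add: o_def)
    ultimately show ?thesis by (simp add: integral_unique flip: of_real_power)
  qed
  then have "((\<lambda>s::real. (2*pi)^2 * (rvec n \<bullet> v)) has_integral
     torus_integral (w + 1 *\<^sub>R v) - torus_integral (w + 0 *\<^sub>R v)) {0..1}"
    by (intro fundamental_theorem_of_calculus) auto
  moreover have "((\<lambda>s::real. (2*pi)^2 * (rvec n \<bullet> v)) has_integral (1 - 0) *\<^sub>R ((2*pi)^2 * (rvec n \<bullet> v))) {0..1}"
    using has_integral_const_real[of "(2*pi)^2 * (rvec n \<bullet> v)" 0 1] by simp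
  ultimately have "torus_integral (w + 1 *\<^sub>R v) - torus_integral (w + 0 *\<^sub>R v) = (1 - 0) *\<^sub>R ((2*pi)^2 * (rvec n \<bullet> v))"
    by (rule has_integral_unique)
  then show ?thesis by simp
qed

lemma ronkin_affine_on_convex:
  assumes "convex B" "\<And>w. w \<in> B \<Longrightarrow> has_order w n" "w \<in> B" "w' \<in> B"
  shows "ronkin H w' - rvec n \<bullet> w' = ronkin H w - rvec n \<bullet> w"
proof -
  have "has_order (w + s *\<^sub>R (w' - w)) n" if "s \<in> {0..1}" for s
  proof -
    have "(1 - s) *\<^sub>R w + s *\<^sub>R w' \<in> B" using that assms by (intro convexD_alt) auto
    then show ?thesis using assms(2) by (simp add: algebra_simps)
  qed
  from torus_integral_segment[OF this]
  have "torus_integral w' - torus_integral w = (2*pi)^2 * (rvec n \<bullet> (w' - w))" by simp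
  moreover have "w \<notin> amoeba H" "w' \<notin> amoeba H"
    using has_order_not_amoeba[OF assms(2)[OF assms(3)]] has_order_not_amoeba[OF assms(2)[OF assms(4)]] .
  ultimately show ?thesis
    by (simp add: ronkin_eq_torus_integral inner_diff_right field_simps)
qed

lemma component_affine:
  assumes "C \<in> components (UNIV - amoeba H)"
  shows "\<exists>n \<tau>. (\<forall>w\<in>C. has_order w n) \<and> (\<forall>w\<in>C. ronkin H w = \<tau> + rvec n \<bullet> w)"
proof -
  have C: "open C" "connected C" "C \<inter> amoeba H = {}" "C \<noteq> {}"
    using assms open_components[OF open_amoeba_complement] in_components_connected
      in_components_subset in_components_nonempty by blast+
  define ord where "ord w = (THE n. has_order w n)" for w
  have ord: "ord w = n" if "has_order w n" for w n
    unfolding ord_def using that order_unique by blast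
  \<comment> \<open>Order and constant term are treated as one function: on a ball in
    \<open>C\<close> both are constant, and \<open>C\<close> is connected.\<close>
  have "(\<lambda>w. (ord w, ronkin H w - rvec (ord w) \<bullet> w)) constant_on C"
  proof (rule locally_constant_imp_constant[OF C(2)])
    fix w assume w: "w \<in> C"
    then obtain r where r: "r > 0" "ball w r \<subseteq> C" using C(1) open_contains_ball by blast
    then obtain n where n: "\<And>x. x \<in> ball w r \<Longrightarrow> has_order x n"
      using convex_has_order[OF convex_ball, of w r] C(3) by blast
    have aff: "ronkin H x - rvec n \<bullet> x = ronkin H w - rvec n \<bullet> w" if "x \<in> ball w r" for x
      using ronkin_affine_on_convex[OF convex_ball[of w r] n _ that, of w] r(1) by (simp only: centre_in_ball)
    show "\<exists>T. openin (top_of_set C) T \<and> w \<in> T \<and> (\<forall>x\<in>T. (ord x, ronkin H x - rvec (ord x) \<bullet> x) = (ord w, ronkin H w - rvec (ord w) \<bullet> w))"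
    proof (intro exI[of _ "ball w r"] conjI ballI)
      show "openin (top_of_set C) (ball w r)" using r(2) by (intro open_subset) auto
      have on: "ord x = n" if "x \<in> ball w r" for x using ord[OF n[OF that]] .
      have w_ball: "w \<in> ball w r" using r(1) by simp
      show "(ord x, ronkin H x - rvec (ord x) \<bullet> x) = (ord w, ronkin H w - rvec (ord w) \<bullet> w)"
        if "x \<in> ball w r" for x
        unfolding on[OF that] on[OF w_ball] aff[OF that] by (rule refl)
    qed (use r in simp)
  qed
  then obtain n \<tau> where c: "\<And>w. w \<in> C \<Longrightarrow> (ord w, ronkin H w - rvec (ord w) \<bullet> w) = (n, \<tau>)"
    unfolding constant_on_def by (metis surj_pair)
  have "has_order w n \<and> ronkin H w = \<tau> + rvec n \<bullet> w" if w: "w \<in> C" for w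
  proof -
    obtain m where m: "has_order w m" using has_order_exists[of w] C(3) w by blast
    with ord c[OF w] show ?thesis by (simp add: algebra_simps)
  qed
  then show ?thesis by blast
qed

text \<open>As \<open>C'\<close> is open, it contains a point reached from \<open>w\<close> in a
  rational direction. The segment to that point avoids the amoeba, so it stays inside
  \<open>C\<close>.\<close>

lemma components_eq_if_same_order:
  assumes C: "C \<in> components (UNIV - amoeba H)" "w \<in> C" "has_order w n"
    and C': "C' \<in> components (UNIV - amoeba H)" "w' \<in> C'" "has_order w' n"
  shows "C = C'"
proof -
  have ord: "has_order x n" if "x \<in> C'" for x
    using component_affine[OF C'(1)] C' order_unique that by metis
  have "open C'" using open_components[OF open_amoeba_complement] C'(1) by blast
  then have "open ((\<lambda>x. x + w) -` C')" by (intro open_vimage continuous_intros)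
  moreover have "w' - w \<in> (\<lambda>x. x + w) -` C'" using C' by simp
  ultimately obtain d :: "int \<times> int" and N :: nat where N: "N > 0"
    "(1 / real N) *\<^sub>R (real_of_int (fst d), real_of_int (snd d)) \<in> (\<lambda>x. x + w) -` C'"
    using open_contains_rational_point by blast
  then have x: "w + (1 / real N) *\<^sub>R rvec d \<in> C'" by (simp add: rvec_def add.commute)
  let ?T = "(\<lambda>\<sigma>. w + \<sigma> *\<^sub>R rvec d) ` {0..1 / real N}"
  have "?T \<subseteq> UNIV - amoeba H"
    using segment_disjoint_amoeba[OF C(3) ord[OF x]] by auto
  moreover have "connected ?T"
    by (intro connected_continuous_image continuous_intros) simp
  moreover have "w \<in> ?T" "w + (1 / real N) *\<^sub>R rvec d \<in> ?T"
    using N(1) by (auto intro: image_eqI[of _ _ 0])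
  ultimately have "w + (1 / real N) *\<^sub>R rvec d \<in> C"
    using components_maximal[OF C(1)] C(2) by blast
  with x components_eq[OF C(1) C'(1)] show ?thesis by blast
qed

text \<open>The quotient of the Laurent polynomial by its dominant monomial stays in the disc of radius \<open>1/2\<close>
  about \<open>1\<close>, where \<open>Ln\<close> is continuous.\<close>

lemma dominant_monomial:
  assumes i: "i \<in> I" "a i \<noteq> 0"
    and dom: "(\<Sum>j\<in>I - {i}. cmod (a j) * exp (rvec (e j) \<bullet> w)) \<le> cmod (a i) * exp (rvec (e i) \<bullet> w) / 2"
  shows "has_order w (e i)" "\<bar>ronkin H w - ln (cmod (a i)) - rvec (e i) \<bullet> w\<bar> \<le> ln 2"
proof -
  define m where "m j \<theta> = a j * exp (of_real (rvec (e j) \<bullet> w) + \<i> * of_real (rvec (e j) \<bullet> \<theta>))" for j \<theta>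
  define h where "h \<theta> = pval w \<theta> / m i \<theta>" for \<theta>
  have norm_m: "cmod (m j \<theta>) = cmod (a j) * exp (rvec (e j) \<bullet> w)" for j \<theta>
    unfolding m_def by (simp add: norm_mult)
  have m_nz: "m i \<theta> \<noteq> 0" for \<theta> using i(2) by (simp add: m_def)
  have pval_h: "pval w \<theta> = m i \<theta> * h \<theta>" for \<theta> using m_nz by (simp add: h_def)
  have h: "cmod (h \<theta> - 1) \<le> 1/2" for \<theta>
  proof -
    have "pval w \<theta> = m i \<theta> + (\<Sum>j\<in>I - {i}. m j \<theta>)"
      unfolding pval_def m_def using finite_I i(1) by (rule sum.remove)
    then have "h \<theta> - 1 = (\<Sum>j\<in>I - {i}. m j \<theta>) / m i \<theta>"
      using m_nz[of \<theta>] by (simp add: h_def add_divide_distrib)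
    moreover have "cmod (\<Sum>j\<in>I - {i}. m j \<theta>) \<le> cmod (m i \<theta>) / 2"
      using norm_sum[of "\<lambda>j. m j \<theta>" "I - {i}"] dom unfolding norm_m by linarith
    ultimately show ?thesis using m_nz[of \<theta>] by (simp only: norm_divide) (simp add: field_simps)
  qed
  have slit: "h \<theta> \<notin> \<real>\<^sub>\<le>\<^sub>0" for \<theta>
    using one_minus_slit[of "1 - h \<theta>"] h[of \<theta>] by (simp add: norm_minus_commute)
  then have h_nz: "h \<theta> \<noteq> 0" for \<theta>
    by (metis complex_nonpos_Reals_iff order_refl zero_complex.sel)
  have cont_m: "continuous_on UNIV (m i)" unfolding m_def by (intro continuous_intros)
  have cont_h: "continuous_on UNIV h"
    unfolding h_def by (intro continuous_intros cont_m) (simp add: m_nz)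
  have m_per: "m i (\<theta> + (2*pi) *\<^sub>R rvec d) = m i \<theta>" for \<theta> d
  proof -
    have "cis (rvec (e i) \<bullet> (\<theta> + (2 * pi) *\<^sub>R rvec d)) = cis (rvec (e i) \<bullet> \<theta>)"
      using cis_multiple_2pi[of "of_int (idot (e i) d)"]
      by (simp add: inner_add_right rvec_inner_rvec mult_ac flip: cis_mult)
    then show ?thesis unfolding m_def exp_real_add_i by simp
  qed
  then have h_per: "h (\<theta> + (2*pi) *\<^sub>R rvec d) = h \<theta>" for \<theta> d
    by (simp add: h_def pval_periodic)
  let ?g = "\<lambda>\<theta>. Ln (a i) + (of_real (rvec (e i) \<bullet> w) + \<i> * of_real (rvec (e i) \<bullet> \<theta>)) + Ln (h \<theta>)"
  show ord: "has_order w (e i)"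
    unfolding has_order_def
  proof (intro exI[of _ ?g] conjI allI)
    show "continuous_on UNIV ?g"
      by (intro continuous_intros cont_h) (simp add: slit)
    show "pval w \<theta> = exp (?g \<theta>)" for \<theta>
      using i(2) h_nz by (simp add: pval_h m_def exp_add)
    show "?g (\<theta> + (2*pi) *\<^sub>R rvec (1,0)) = ?g \<theta> + 2 * pi * real_of_int (fst (e i)) * \<i>" for \<theta>
      using h_per rvec_inner_rvec[of "e i" "(1,0)"] by (simp add: inner_add_right idot_def algebra_simps)
    show "?g (\<theta> + (2*pi) *\<^sub>R rvec (0,1)) = ?g \<theta> + 2 * pi * real_of_int (snd (e i)) * \<i>" for \<theta>
      using h_per rvec_inner_rvec[of "e i" "(0,1)"] by (simp add: inner_add_right idot_def algebra_simps)
  qed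
  let ?c = "ln (cmod (a i)) + rvec (e i) \<bullet> w"
  \<comment> \<open>The quotient \<open>h\<close> has modulus between 1/2 and 2, and averaging over
    the torus, of volume \<open>(2*pi)^2\<close>, preserves the resulting bound.\<close>
  have ptw: "\<bar>ln (cmod (pval w \<theta>)) - ?c\<bar> \<le> ln 2" for \<theta>
  proof -
    have "ln (cmod (pval w \<theta>)) = ?c + ln (cmod (h \<theta>))"
      using i(2) h_nz by (simp add: pval_h norm_mult norm_m ln_mult)
    moreover have "1/2 \<le> cmod (h \<theta>)" "cmod (h \<theta>) \<le> 2"
      using h[of \<theta>] norm_triangle_ineq2[of 1 "h \<theta>"] norm_triangle_ineq2[of "h \<theta>" 1]
        norm_minus_commute[of 1 "h \<theta>"] by (simp, simp)
    then have "ln (1/2) \<le> ln (cmod (h \<theta>))" "ln (cmod (h \<theta>)) \<le> ln 2"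
      using h_nz by (subst ln_le_cancel_iff; simp)+
    ultimately show ?thesis by (simp add: ln_div)
  qed
  have nz: "pval w \<theta> \<noteq> 0" for \<theta> using has_order_not_amoeba[OF ord] amoeba_iff by blast
  have "(\<lambda>\<theta>. ln (cmod (pval w \<theta>)) - ?c) integrable_on cbox (0,0) (2*pi,2*pi)"
    by (intro integrable_continuous continuous_intros) (use nz in auto)
  moreover have 1: "(\<lambda>\<theta>. ln (cmod (pval w \<theta>))) integrable_on cbox (0,0) (2*pi,2*pi)"
    by (intro integrable_continuous continuous_intros) (use nz in auto)
  ultimately have "\<bar>integral (cbox (0,0) (2*pi,2*pi)) (\<lambda>\<theta>. ln (cmod (pval w \<theta>)) - ?c)\<bar> \<le>
     integral (cbox (0,0) (2*pi,2*pi)) (\<lambda>\<theta>::real\<times>real. ln 2)"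
    using integral_norm_bound_integral[of "\<lambda>\<theta>. ln (cmod (pval w \<theta>)) - ?c" "cbox (0,0) (2*pi,2*pi)" "\<lambda>_. ln 2"] ptw
    by auto
  also have "integral (cbox (0,0) (2*pi,2*pi)) (\<lambda>\<theta>. ln (cmod (pval w \<theta>)) - ?c) = torus_integral w - (2*pi)^2 * ?c"
    unfolding torus_integral_def using 1
    by (subst integral_diff) (auto simp: content_Pair power2_eq_square)
  finally have "\<bar>torus_integral w - (2*pi)^2 * ?c\<bar> \<le> (2*pi)^2 * ln 2"
    by (simp add: content_Pair power2_eq_square)
  then have "\<bar>torus_integral w - (2*pi)^2 * ?c\<bar> / (2*pi)^2 \<le> ln 2"
    by (simp add: field_simps)
  also have "\<bar>torus_integral w - (2*pi)^2 * ?c\<bar> / (2*pi)^2 = \<bar>torus_integral w / (2*pi)^2 - ?c\<bar>"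
  proof -
    have scale: "\<bar>x - D * c\<bar> / D = \<bar>x / D - c\<bar>" if "D > 0" for x D c :: real
      using that by (simp add: abs_div_pos diff_divide_distrib)
    show ?thesis by (rule scale) simp
  qed
  finally show "\<bar>ronkin H w - ln (cmod (a i)) - rvec (e i) \<bullet> w\<bar> \<le> ln 2"
    using has_order_not_amoeba[OF ord] by (simp add: ronkin_eq_torus_integral algebra_simps)
qed

text \<open>Every exponent is the order of the component in which its monomial dominates. Conversely
  the order of a component is a lattice point of the hull, hence an exponent, and equality of orders
  identifies the two components.\<close>

theorem comp_affine_eq:
  assumes lattice: "\<And>n. rvec n \<in> convex hull (\<lambda>i. rvec (e i)) ` I \<Longrightarrow> n \<in> e ` I"
    and nz: "\<And>i. i \<in> I \<Longrightarrow> a i \<noteq> 0"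
    and dom: "\<And>i. i \<in> I \<Longrightarrow> \<exists>w. (\<Sum>j\<in>I - {i}. cmod (a j) * exp (rvec (e j) \<bullet> w)) \<le> cmod (a i) * exp (rvec (e i) \<bullet> w) / 2"
  shows "\<exists>\<tau>. comp_affine H = (\<lambda>i. (\<tau> i, rvec (e i))) ` I \<and> (\<forall>i\<in>I. \<bar>\<tau> i - ln (cmod (a i))\<bar> \<le> ln 2)"
proof -
  have "\<exists>w. has_order w (e i) \<and> \<bar>ronkin H w - ln (cmod (a i)) - rvec (e i) \<bullet> w\<bar> \<le> ln 2"
    if "i \<in> I" for i
    using dom[OF that] dominant_monomial[OF that nz[OF that]] by blast
  then obtain w where w: "\<And>i. i \<in> I \<Longrightarrow> has_order (w i) (e i)"
    "\<And>i. i \<in> I \<Longrightarrow> \<bar>ronkin H (w i) - ln (cmod (a i)) - rvec (e i) \<bullet> w i\<bar> \<le> ln 2"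
    by metis
  define \<tau> where "\<tau> i = ronkin H (w i) - rvec (e i) \<bullet> w i" for i
  have comp: "\<forall>x\<in>C. ronkin H x = \<tau> i + rvec (e i) \<bullet> x"
    if C: "C \<in> components (UNIV - amoeba H)" "w i \<in> C" "i \<in> I" for C i
  proof -
    obtain n t where n: "\<forall>x\<in>C. has_order x n" "\<forall>x\<in>C. ronkin H x = t + rvec n \<bullet> x"
      using component_affine[OF C(1)] by blast
    moreover have "n = e i" using n w order_unique C by blast
    ultimately show ?thesis using C(2) by (simp add: \<tau>_def)
  qed
  have "comp_affine H = (\<lambda>i. (\<tau> i, rvec (e i))) ` I"
  proof (intro equalityI subsetI)
    fix f assume "f \<in> comp_affine H"
    then obtain t v C where f: "f = (t, v)" "C \<in> components (UNIV - amoeba H)" "\<forall>x\<in>C. ronkin H x = t + v \<bullet> x"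
      unfolding comp_affine_def by blast
    have C: "open C" "C \<noteq> {}"
      using f(2) open_components[OF open_amoeba_complement] in_components_nonempty by blast+
    then obtain x where x: "x \<in> C" by blast
    obtain n where n: "\<forall>x\<in>C. has_order x n"
      using component_affine[OF f(2)] by blast
    obtain i where i: "i \<in> I" "n = e i"
      using lattice[OF order_in_hull] n x by blast
    have "w i \<in> UNIV - amoeba H" using w(1)[OF i(1)] has_order_not_amoeba by blast
    then obtain D where D: "D \<in> components (UNIV - amoeba H)" "w i \<in> D"
      by (metis UnionE Union_components)
    have "C = D"
      using components_eq_if_same_order[OF f(2) x _ D] n x i w(1) by blast
    then have aff: "\<forall>x\<in>C. t + v \<bullet> x = \<tau> i + rvec (e i) \<bullet> x"
      using comp[OF D i(1)] f(3) by simp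
    obtain r where r: "r > 0" "ball x r \<subseteq> C" using C(1) x open_contains_ball by blast
    let ?u = "v - rvec (e i)"
    \<comment> \<open>\<open>comp_affine\<close> admits arbitrary real gradients, so the gradient
      has to be recovered: two affine functions agreeing on a ball have equal gradients, as a step
      of length \<open>r / 2\<close> along their difference shows.\<close>
    have "?u = 0"
    proof (rule ccontr)
      assume u: "?u \<noteq> 0"
      define y where "y = x + (r / 2 / norm ?u) *\<^sub>R ?u"
      have "y \<in> C" using r u by (auto simp: y_def dist_norm)
      then have "?u \<bullet> y = ?u \<bullet> x" using aff x by (simp add: inner_diff_left) (smt (verit))
      then have "(r / 2 / norm ?u) * (?u \<bullet> ?u) = 0" by (simp add: y_def inner_add_right)
      with u r show False by simp
    qed
    moreover have "t = \<tau> i" using bspec[OF aff x] calculation by simp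
    ultimately show "f \<in> (\<lambda>i. (\<tau> i, rvec (e i))) ` I" using i(1) f(1) by auto
  next
    fix f assume "f \<in> (\<lambda>i. (\<tau> i, rvec (e i))) ` I"
    then obtain i where i: "i \<in> I" "f = (\<tau> i, rvec (e i))" by blast
    have "w i \<in> UNIV - amoeba H" using w(1)[OF i(1)] has_order_not_amoeba by blast
    then obtain D where D: "D \<in> components (UNIV - amoeba H)" "w i \<in> D"
      by (metis UnionE Union_components)
    with comp[OF D i(1)] i(2) show "f \<in> comp_affine H" unfolding comp_affine_def by blast
  qed
  moreover have "\<forall>i\<in>I. \<bar>\<tau> i - ln (cmod (a i))\<bar> \<le> ln 2"
    using w(2) by (auto simp: \<tau>_def algebra_simps)
  ultimately show ?thesis by blast
qed

end

section \<open>Duality for regular unimodular triangulations\<close>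

lemma ptR_eq_rvec: "ptR b i = rvec (b i)"
  by (simp add: ptR_def rvec_def)

lemma unimodular_triangle_finite: "unimodular_triangle b \<sigma> \<Longrightarrow> finite \<sigma>"
  unfolding unimodular_triangle_def by auto

lemma unimodular_affine_interpolation:
  assumes "unimodular_triangle b \<sigma>"
  shows "\<exists>d c. \<forall>i\<in>\<sigma>. ptR b i \<bullet> d + c = f i"
proof -
  obtain i j k where \<sigma>: "\<sigma> = {i,j,k}" and det: "\<bar>(fst (b j) - fst (b i)) * (snd (b k) - snd (b i))
          - (snd (b j) - snd (b i)) * (fst (b k) - fst (b i))\<bar> = 1"
    using assms unfolding unimodular_triangle_def by blast
  define x1 y1 x2 y2 where "x1 = real_of_int (fst (b j) - fst (b i))" "y1 = real_of_int (snd (b j) - snd (b i))"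
    "x2 = real_of_int (fst (b k) - fst (b i))" "y2 = real_of_int (snd (b k) - snd (b i))"
  note xy = this
  define D where "D = x1 * y2 - y1 * x2"
  have "real_of_int \<bar>(fst (b j) - fst (b i)) * (snd (b k) - snd (b i))
          - (snd (b j) - snd (b i)) * (fst (b k) - fst (b i))\<bar> = 1"
    using det by simp
  then have D: "D \<noteq> 0" by (auto simp: D_def xy)
  define \<alpha> \<beta> where "\<alpha> = f j - f i" "\<beta> = f k - f i"
  note ab = this
  \<comment> \<open>Cramer's rule for the two edge vectors at vertex \<open>i\<close>.\<close>
  define d where "d = ((\<alpha> * y2 - \<beta> * y1) / D, (x1 * \<beta> - x2 * \<alpha>) / D)"
  have "x1 * ((\<alpha> * y2 - \<beta> * y1) / D) + y1 * ((x1 * \<beta> - x2 * \<alpha>) / D) = \<alpha> * D / D"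
    unfolding times_divide_eq_right add_divide_distrib[symmetric] by (simp add: D_def algebra_simps)
  then have 1: "x1 * fst d + y1 * snd d = \<alpha>" using D by (simp add: d_def)
  have "x2 * ((\<alpha> * y2 - \<beta> * y1) / D) + y2 * ((x1 * \<beta> - x2 * \<alpha>) / D) = \<beta> * D / D"
    unfolding times_divide_eq_right add_divide_distrib[symmetric] by (simp add: D_def algebra_simps)
  then have 2: "x2 * fst d + y2 * snd d = \<beta>" using D by (simp add: d_def)
  have "\<forall>l\<in>\<sigma>. ptR b l \<bullet> d + (f i - ptR b i \<bullet> d) = f l"
    using 1 2 unfolding \<sigma> by (simp add: xy ab ptR_def inner_prod_def algebra_simps)
  then show ?thesis by blast
qed

lemma unimodular_barycentric:
  assumes "unimodular_triangle b \<sigma>"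
  shows "\<exists>\<mu>::nat \<Rightarrow> int. (\<Sum>i\<in>\<sigma>. \<mu> i) = 1 \<and> (\<Sum>i\<in>\<sigma>. \<mu> i * fst (b i)) = fst z \<and> (\<Sum>i\<in>\<sigma>. \<mu> i * snd (b i)) = snd z"
proof -
  obtain i j k where \<sigma>: "\<sigma> = {i,j,k}" and det: "\<bar>(fst (b j) - fst (b i)) * (snd (b k) - snd (b i))
          - (snd (b j) - snd (b i)) * (fst (b k) - fst (b i))\<bar> = 1"
    using assms unfolding unimodular_triangle_def by blast
  have dist: "i \<noteq> j" "i \<noteq> k" "j \<noteq> k" using det by (auto simp: algebra_simps)
  define x1 y1 x2 y2 x y where "x1 = fst (b j) - fst (b i)" "y1 = snd (b j) - snd (b i)"
    "x2 = fst (b k) - fst (b i)" "y2 = snd (b k) - snd (b i)" "x = fst z - fst (b i)" "y = snd z - snd (b i)"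
  note xy = this
  define D where "D = x1 * y2 - y1 * x2"
  \<comment> \<open>The determinant is its own inverse, so Cramer's rule multiplies by
    \<open>D\<close> instead of dividing and the coordinates stay integral.\<close>
  have D: "D * D = 1" using det unfolding D_def xy by (metis abs_mult_self_eq mult_1)
  define \<beta> \<gamma> where "\<beta> = (x * y2 - y * x2) * D" "\<gamma> = (x1 * y - y1 * x) * D"
  note bg = this
  have "\<beta> * x1 + \<gamma> * x2 = x * (D * D)" by (simp add: bg D_def algebra_simps)
  then have 1: "\<beta> * x1 + \<gamma> * x2 = x" using D by simp
  have "\<beta> * y1 + \<gamma> * y2 = y * (D * D)" by (simp add: bg D_def algebra_simps)
  then have 2: "\<beta> * y1 + \<gamma> * y2 = y" using D by simp
  define \<mu> where "\<mu> l = (if l = i then 1 - \<beta> - \<gamma> else if l = j then \<beta> else \<gamma>)" for l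
  have \<mu>: "\<mu> i = 1 - \<beta> - \<gamma>" "\<mu> j = \<beta>" "\<mu> k = \<gamma>" using dist by (auto simp: \<mu>_def)
  have "(\<Sum>i\<in>\<sigma>. \<mu> i) = 1" "(\<Sum>i\<in>\<sigma>. \<mu> i * fst (b i)) = fst z" "(\<Sum>i\<in>\<sigma>. \<mu> i * snd (b i)) = snd z"
    using 1 2 dist unfolding \<sigma> by (simp_all add: \<mu> xy algebra_simps)
  then show ?thesis by blast
qed

lemma barycentric_ptR:
  assumes "(\<Sum>i\<in>\<sigma>. \<mu> i * fst (b i)) = fst z" "(\<Sum>i\<in>\<sigma>. \<mu> i * snd (b i)) = snd z"
  shows "(\<Sum>i\<in>\<sigma>. real_of_int (\<mu> i) * (ptR b i \<bullet> d)) = rvec z \<bullet> d"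
proof -
  have "(\<Sum>i\<in>\<sigma>. real_of_int (\<mu> i) * (ptR b i \<bullet> d)) =
     real_of_int (\<Sum>i\<in>\<sigma>. \<mu> i * fst (b i)) * fst d + real_of_int (\<Sum>i\<in>\<sigma>. \<mu> i * snd (b i)) * snd d"
    by (simp add: ptR_def inner_prod_def sum_distrib_left sum_distrib_right algebra_simps flip: sum.distrib)
  then show ?thesis unfolding assms by (simp add: rvec_def inner_prod_def)
qed

text \<open>Weights are indexed by the vertex labels rather than by the points, so that they can be
  paired with heights.\<close>

lemma simp_hull_explicit:
  assumes "finite S" "y \<in> simp_hull b S"
  shows "\<exists>u. (\<forall>i\<in>S. 0 \<le> u i) \<and> sum u S = 1 \<and> (\<Sum>i\<in>S. u i *\<^sub>R ptR b i) = y"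
proof -
  have "convex hull (ptR b ` S) \<subseteq> {y. \<exists>u. (\<forall>i\<in>S. 0 \<le> u i) \<and> sum u S = 1 \<and> (\<Sum>i\<in>S. u i *\<^sub>R ptR b i) = y}"
  proof (rule hull_minimal)
    show "ptR b ` S \<subseteq> {y. \<exists>u. (\<forall>i\<in>S. 0 \<le> u i) \<and> sum u S = 1 \<and> (\<Sum>i\<in>S. u i *\<^sub>R ptR b i) = y}"
    proof (rule image_subsetI, rule CollectI)
      fix j assume "j \<in> S"
      then have "sum (\<lambda>i. if i = j then 1 else 0) S = (1::real)"
        "(\<Sum>i\<in>S. (if i = j then 1 else 0) *\<^sub>R ptR b i) = ptR b j"
        using assms(1) by (auto simp: if_distrib[of "\<lambda>c. c *\<^sub>R _"] cong: if_cong)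
      then show "\<exists>u. (\<forall>i\<in>S. 0 \<le> u i) \<and> sum u S = 1 \<and> (\<Sum>i\<in>S. u i *\<^sub>R ptR b i) = ptR b j"
        by (intro exI[of _ "\<lambda>i. if i = j then 1 else 0"]) auto
    qed
    show "convex {y. \<exists>u. (\<forall>i\<in>S. 0 \<le> u i) \<and> sum u S = 1 \<and> (\<Sum>i\<in>S. u i *\<^sub>R ptR b i) = y}"
    proof (rule convexI)
      fix s t :: real and x y
      assume st: "0 \<le> s" "0 \<le> t" "s + t = 1"
        and xy: "x \<in> {y. \<exists>u. (\<forall>i\<in>S. 0 \<le> u i) \<and> sum u S = 1 \<and> (\<Sum>i\<in>S. u i *\<^sub>R ptR b i) = y}"
          "y \<in> {y. \<exists>u. (\<forall>i\<in>S. 0 \<le> u i) \<and> sum u S = 1 \<and> (\<Sum>i\<in>S. u i *\<^sub>R ptR b i) = y}"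
      then obtain u v where u: "\<forall>i\<in>S. 0 \<le> u i" "sum u S = 1" "(\<Sum>i\<in>S. u i *\<^sub>R ptR b i) = x"
        and v: "\<forall>i\<in>S. 0 \<le> v i" "sum v S = 1" "(\<Sum>i\<in>S. v i *\<^sub>R ptR b i) = y"
        by blast
      have "(\<Sum>i\<in>S. (s * u i + t * v i) *\<^sub>R ptR b i) = s *\<^sub>R x + t *\<^sub>R y"
        unfolding u(3)[symmetric] v(3)[symmetric]
        by (simp add: scaleR_left_distrib sum.distrib scaleR_right.sum)
      moreover have "sum (\<lambda>i. s * u i + t * v i) S = 1"
        using st u(2) v(2) by (simp add: sum.distrib flip: sum_distrib_left)
      ultimately show "s *\<^sub>R x + t *\<^sub>R y \<in> {y. \<exists>u. (\<forall>i\<in>S. 0 \<le> u i) \<and> sum u S = 1 \<and> (\<Sum>i\<in>S. u i *\<^sub>R ptR b i) = y}"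
        using st u(1) v(1) by (intro CollectI exI[of _ "\<lambda>i. s * u i + t * v i"]) auto
    qed
  qed
  then show ?thesis using assms(2) unfolding simp_hull_def by blast
qed

text \<open>The convex weights of a lattice point coincide with its integer barycentric coordinates.
  Nonnegative integers of sum 1 are all 0 except for a single 1.\<close>

lemma unimodular_vertex_in_face:
  assumes uni: "unimodular_triangle b \<sigma>" and S: "S \<subseteq> \<sigma>" and z: "rvec z \<in> simp_hull b S"
  shows "z \<in> b ` S"
proof -
  have fin: "finite \<sigma>" "finite S" using unimodular_triangle_finite[OF uni] S finite_subset by auto
  obtain u where u: "\<forall>i\<in>S. 0 \<le> u i" "sum u S = 1" "(\<Sum>i\<in>S. u i *\<^sub>R ptR b i) = rvec z"
    using simp_hull_explicit[OF fin(2) z] by blast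
  obtain \<mu> where \<mu>: "(\<Sum>i\<in>\<sigma>. \<mu> i) = 1" "(\<Sum>i\<in>\<sigma>. \<mu> i * fst (b i)) = fst z" "(\<Sum>i\<in>\<sigma>. \<mu> i * snd (b i)) = snd z"
    using unimodular_barycentric[OF uni] by blast
  have eq: "real_of_int (\<mu> i) = (if i \<in> S then u i else 0)" if i: "i \<in> \<sigma>" for i
  proof -
    \<comment> \<open>The affine function with value 1 at vertex \<open>i\<close> and 0 at the
      others reads off the \<open>i\<close>-th coordinate from both representations.\<close>
    obtain d c where dc: "\<forall>j\<in>\<sigma>. ptR b j \<bullet> d + c = (if j = i then 1 else 0)"
      using unimodular_affine_interpolation[OF uni, of "\<lambda>j. if j = i then 1 else 0"] by blast
    have "rvec z \<bullet> d + c = (\<Sum>j\<in>\<sigma>. real_of_int (\<mu> j) * (ptR b j \<bullet> d + c))"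
      using \<mu>(1) barycentric_ptR[OF \<mu>(2,3), of d]
      by (simp add: distrib_left sum.distrib flip: sum_distrib_right of_int_sum)
    also have "\<dots> = (\<Sum>j\<in>\<sigma>. if j = i then real_of_int (\<mu> j) else 0)"
      using dc by (intro sum.cong) auto
    also have "\<dots> = real_of_int (\<mu> i)" using i fin by simp
    finally have 1: "rvec z \<bullet> d + c = real_of_int (\<mu> i)" .
    have "rvec z \<bullet> d + c = (\<Sum>j\<in>S. u j * (ptR b j \<bullet> d + c))"
      using u(2) by (simp add: u(3)[symmetric] inner_sum_left distrib_left sum.distrib flip: sum_distrib_right)
    also have "\<dots> = (\<Sum>j\<in>S. if j = i then u j else 0)"
      using dc S by (intro sum.cong) auto
    also have "\<dots> = (if i \<in> S then u i else 0)" using fin by simp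
    finally show ?thesis using 1 by simp
  qed
  have nonneg: "0 \<le> \<mu> i" if "i \<in> \<sigma>" for i
    using eq[OF that] u(1) by (metis (full_types) of_int_0_le_iff order_refl)
  have "\<exists>i\<in>\<sigma>. \<mu> i \<noteq> 0"
    using \<mu>(1) by (metis sum.neutral zero_neq_one)
  then obtain i where i: "i \<in> \<sigma>" "\<mu> i \<noteq> 0" by blast
  then have "i \<in> S" using eq[OF i(1)] by (auto split: if_splits)
  have "\<mu> i \<ge> 1" using nonneg i by force
  moreover have "\<mu> i + (\<Sum>j\<in>\<sigma> - {i}. \<mu> j) = 1"
    using \<mu>(1) fin i(1) by (simp add: sum.remove)
  moreover have "(\<Sum>j\<in>\<sigma> - {i}. \<mu> j) \<ge> 0" using nonneg by (intro sum_nonneg) auto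
  ultimately have one: "\<mu> i = 1" "(\<Sum>j\<in>\<sigma> - {i}. \<mu> j) = 0" by linarith+
  then have zero: "\<forall>j\<in>\<sigma> - {i}. \<mu> j = 0"
    using nonneg fin by (subst (asm) sum_nonneg_eq_0_iff) auto
  have "(\<Sum>j\<in>\<sigma>. \<mu> j * f j) = f i" for f :: "nat \<Rightarrow> int"
    using fin i(1) zero one(1) by (simp add: sum.remove)
  then have "z = b i" using \<mu>(2,3) by (simp add: prod_eq_iff)
  with \<open>i \<in> S\<close> show ?thesis by blast
qed

lemma finite_small_positive:
  fixes f g :: "'a \<Rightarrow> real"
  assumes "finite J" "\<And>j. j \<in> J \<Longrightarrow> 0 < g j"
  shows "\<exists>\<epsilon>>0. \<forall>j\<in>J. \<epsilon> * f j < g j"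
  using assms
proof (induction J rule: finite_induct)
  case empty
  then show ?case by (auto intro: exI[of _ 1])
next
  case (insert x J)
  then obtain \<epsilon> where \<epsilon>: "\<epsilon> > 0" "\<forall>j\<in>J. \<epsilon> * f j < g j" by auto
  \<comment> \<open>The second bound gives \<open>\<delta> * f x \<le> g x / 2\<close>; the added 1
    keeps the denominator positive.\<close>
  define \<delta> where "\<delta> = min \<epsilon> (g x / (2 * (\<bar>f x\<bar> + 1)))"
  have gx: "g x > 0" using insert.prems by simp
  have \<delta>: "\<delta> > 0" using \<epsilon>(1) gx by (simp add: \<delta>_def)
  have "\<delta> * f y < g y" if "y \<in> J" for y
  proof (cases "f y \<ge> 0")
    case True
    then have "\<delta> * f y \<le> \<epsilon> * f y" by (intro mult_right_mono) (simp_all add: \<delta>_def)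
    with \<epsilon>(2) that show ?thesis by force
  next
    case False
    then have "\<delta> * f y < 0" using \<delta> by (simp add: mult_pos_neg)
    with insert.prems that show ?thesis by (meson insertCI order_less_trans)
  qed
  moreover have "\<delta> * f x < g x"
  proof -
    have "\<delta> * f x \<le> \<delta> * (\<bar>f x\<bar> + 1)" using \<delta> by (intro mult_left_mono) auto
    also have "\<dots> \<le> g x / (2 * (\<bar>f x\<bar> + 1)) * (\<bar>f x\<bar> + 1)"
      by (intro mult_right_mono) (simp_all add: \<delta>_def)
    also have "\<dots> = g x / 2" by (simp add: field_simps)
    finally show ?thesis using gx by simp
  qed
  ultimately show ?case using \<delta> by blast
qed

section \<open>The tropical curve of a height function\<close>

text \<open>In \<open>regular\<close>, the point \<open>w\<close> is the vertex of the tropical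
  curve dual to the triangle: the affine functions of its three corners tie there, strictly above
  all others.\<close>

locale regular_triangulation =
  fixes b :: "nat \<Rightarrow> int \<times> int" and I :: "nat set" and TS :: "nat set set" and \<tau> :: "nat \<Rightarrow> real"
  assumes finite_I: "finite I" and inj_b: "inj_on b I"
    and subset_I: "\<And>\<sigma>. \<sigma> \<in> TS \<Longrightarrow> \<sigma> \<subseteq> I"
    and unimodular: "\<And>\<sigma>. \<sigma> \<in> TS \<Longrightarrow> unimodular_triangle b \<sigma>"
    and cover: "(\<Union>\<sigma>\<in>TS. simp_hull b \<sigma>) = convex hull (ptR b ` I)"
    and regular: "\<And>\<sigma>. \<sigma> \<in> TS \<Longrightarrow> \<exists>w h. (\<forall>i\<in>\<sigma>. \<tau> i + ptR b i \<bullet> w = h) \<and> (\<forall>j\<in>I - \<sigma>. \<tau> j + ptR b j \<bullet> w < h)"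
begin

definition val :: "nat \<Rightarrow> real \<times> real \<Rightarrow> real" where
  "val i w = \<tau> i + ptR b i \<bullet> w"

definition cell :: "nat set \<Rightarrow> (real \<times> real) set" where
  "cell S = {w. \<forall>i\<in>S. \<forall>j\<in>I. val j w \<le> val i w}"

definition faces :: "nat set set" where
  "faces = {S. S \<noteq> {} \<and> (\<exists>\<sigma>\<in>TS. S \<subseteq> \<sigma>)}"

text \<open>Comparing the affine function of \<open>w\<close> with that of a triangle containing the barycentre of \<open>S\<close>
  at this barycentre forces them to agree on all of \<open>S\<close>.\<close>

lemma cell_nonempty_imp_face:
  assumes w: "w \<in> cell S" and S: "S \<subseteq> I" "S \<noteq> {}"
  shows "S \<in> faces"
proof -
  have fin: "finite S" using S finite_I finite_subset by blast
  then have card: "real (card S) > 0" using S(2) by (simp add: card_gt_0_iff)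
  define y where "y = (\<Sum>i\<in>S. (1 / real (card S)) *\<^sub>R ptR b i)"
  have "y \<in> convex hull (ptR b ` I)"
    unfolding y_def using fin card S
    by (intro convex_sum) (auto intro: hull_inc)
  then obtain \<sigma> where \<sigma>: "\<sigma> \<in> TS" "y \<in> simp_hull b \<sigma>" using cover by blast
  have fin\<sigma>: "finite \<sigma>" using unimodular_triangle_finite[OF unimodular[OF \<sigma>(1)]] .
  obtain u where u: "\<forall>i\<in>\<sigma>. 0 \<le> u i" "sum u \<sigma> = 1" "(\<Sum>i\<in>\<sigma>. u i *\<^sub>R ptR b i) = y"
    using simp_hull_explicit[OF fin\<sigma> \<sigma>(2)] by blast
  obtain w' h' where h': "\<forall>i\<in>\<sigma>. val i w' = h'" "\<forall>j\<in>I - \<sigma>. val j w' < h'"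
    using regular[OF \<sigma>(1)] unfolding val_def by blast
  obtain i0 where i0: "i0 \<in> S" using S(2) by blast
  define h where "h = val i0 w"
  have h: "val i w = h" if "i \<in> S" for i
    using w that i0 S(1) unfolding cell_def h_def by (auto intro: antisym)
  have le_h: "val j w \<le> h" if "j \<in> I" for j
    using w that i0 unfolding cell_def h_def by blast
  \<comment> \<open>\<open>T / card S\<close> and \<open>T'\<close> are two averaged heights over
    \<open>y\<close>. Maximality at \<open>w\<close> gives
    \<open>h - y \<bullet> w \<ge> T' = h' - y \<bullet> w'\<close>, while an index of
    \<open>S\<close> outside \<open>\<sigma>\<close> would give the reverse strict
    inequality.\<close>
  define T where "T = (\<Sum>i\<in>S. \<tau> i)"
  define T' where "T' = (\<Sum>i\<in>\<sigma>. u i * \<tau> i)"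
  have y_S: "(\<Sum>i\<in>S. val i x) = T + real (card S) * (y \<bullet> x)" for x
    using card by (simp add: val_def T_def y_def sum.distrib inner_sum_left flip: sum_divide_distrib)
  have y_\<sigma>: "(\<Sum>i\<in>\<sigma>. u i * val i x) = T' + y \<bullet> x" for x
    by (simp add: val_def T'_def u(3)[symmetric] distrib_left sum.distrib inner_sum_left)
  have 1: "T + real (card S) * (y \<bullet> w) = real (card S) * h"
    unfolding y_S[symmetric] using h by simp
  have 2: "T' + y \<bullet> w' = h'"
    unfolding y_\<sigma>[symmetric] using h'(1) u(2) by (simp flip: sum_distrib_right)
  have "(\<Sum>i\<in>\<sigma>. u i * val i w) \<le> (\<Sum>i\<in>\<sigma>. u i * h)"
    using u(1) le_h subset_I[OF \<sigma>(1)] by (intro sum_mono mult_left_mono) auto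
  then have 3: "T' + y \<bullet> w \<le> h"
    unfolding y_\<sigma> using u(2) by (simp flip: sum_distrib_right)
  have le_h': "val i w' \<le> h'" if "i \<in> S" for i
    using h' S(1) that by (cases "i \<in> \<sigma>") (auto intro: less_imp_le)
  have "S \<subseteq> \<sigma>"
  proof (rule ccontr)
    assume "\<not> S \<subseteq> \<sigma>"
    then have "(\<Sum>i\<in>S. val i w') < (\<Sum>i\<in>S. h')"
      using fin le_h' h'(2) S(1) by (intro sum_strict_mono_ex1) auto
    then have "T + real (card S) * (y \<bullet> w') < real (card S) * h'"
      unfolding y_S by simp
    with 1 have "real (card S) * h - real (card S) * (y \<bullet> w) < real (card S) * h' - real (card S) * (y \<bullet> w')"
      by linarith
    then have "real (card S) * (h - y \<bullet> w) < real (card S) * (h' - y \<bullet> w')"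
      by (simp add: right_diff_distrib)
    then have "h - y \<bullet> w < h' - y \<bullet> w'" using card by simp
    with 2 3 show False by linarith
  qed
  with S(2) \<sigma>(1) show ?thesis unfolding faces_def by blast
qed

text \<open>From the vertex dual to a triangle containing \<open>S\<close>, a small step in a
  direction favouring exactly the corners in \<open>S\<close> breaks the tie with the other corners
  and keeps the remaining indices below.\<close>

lemma face_interior_point:
  assumes "S \<in> faces"
  shows "\<exists>w h. (\<forall>i\<in>S. val i w = h) \<and> (\<forall>j\<in>I - S. val j w < h)"
proof -
  obtain \<sigma> where \<sigma>: "\<sigma> \<in> TS" "S \<subseteq> \<sigma>" using assms unfolding faces_def by blast
  obtain w h where h: "\<forall>i\<in>\<sigma>. val i w = h" "\<forall>j\<in>I - \<sigma>. val j w < h"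
    using regular[OF \<sigma>(1)] unfolding val_def by blast
  obtain d c where dc: "\<forall>i\<in>\<sigma>. ptR b i \<bullet> d + c = (if i \<in> S then 1 else 0)"
    using unimodular_affine_interpolation[OF unimodular[OF \<sigma>(1)], of "\<lambda>i. if i \<in> S then 1 else 0"] by blast
  obtain \<epsilon> where \<epsilon>: "\<epsilon> > 0" "\<forall>j\<in>I - \<sigma>. \<epsilon> * (ptR b j \<bullet> d + c - 1) < h - val j w"
    using finite_small_positive[of "I - \<sigma>" "\<lambda>j. h - val j w" "\<lambda>j. ptR b j \<bullet> d + c - 1"] finite_I h(2) by auto
  have v: "val j (w + \<epsilon> *\<^sub>R d) = val j w + \<epsilon> * (ptR b j \<bullet> d + c - 1) + \<epsilon> * (1 - c)" for j
    by (simp add: val_def inner_add_right algebra_simps)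
  have "val i (w + \<epsilon> *\<^sub>R d) = h + \<epsilon> * (1 - c)" if "i \<in> S" for i
    using dc h(1) \<sigma>(2) that unfolding v by (simp add: subset_iff)
  moreover have "val j (w + \<epsilon> *\<^sub>R d) < h + \<epsilon> * (1 - c)" if "j \<in> I - S" for j
  proof (cases "j \<in> \<sigma>")
    case True
    then show ?thesis using dc h(1) that \<epsilon>(1) unfolding v by simp
  next
    case False
    then have "\<epsilon> * (ptR b j \<bullet> d + c - 1) < h - val j w" using \<epsilon>(2) that by blast
    then show ?thesis unfolding v by linarith
  qed
  ultimately show ?thesis by blast
qed

lemma faces_subset_I: "S \<in> faces \<Longrightarrow> S \<subseteq> I"
  unfolding faces_def using subset_I by blast

lemma face_interior_point_in_cell:
  assumes "S \<in> faces" "\<forall>i\<in>S. val i w = h" "\<forall>j\<in>I - S. val j w < h"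
  shows "w \<in> cell S"
  unfolding cell_def
proof (intro CollectI ballI)
  fix i j assume "i \<in> S" "j \<in> I"
  then show "val j w \<le> val i w"
    using assms(2,3) by (cases "j \<in> S") (auto intro: less_imp_le)
qed

text \<open>At a relative interior point of \<open>cell S\<close> the maximal indices are exactly
  those of \<open>S\<close>, so the cell determines its face.\<close>

lemma cell_subset_iff:
  assumes "S \<in> faces" "S' \<in> faces"
  shows "cell S \<subseteq> cell S' \<longleftrightarrow> S' \<subseteq> S"
proof
  assume sub: "cell S \<subseteq> cell S'"
  obtain w h where h: "\<forall>i\<in>S. val i w = h" "\<forall>j\<in>I - S. val j w < h"
    using face_interior_point[OF assms(1)] by blast
  then have w: "w \<in> cell S'" using sub face_interior_point_in_cell[OF assms(1)] by blast
  obtain i where i: "i \<in> S" using assms(1) unfolding faces_def by blast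
  show "S' \<subseteq> S"
  proof
    fix j assume j: "j \<in> S'"
    then have "val i w \<le> val j w" "j \<in> I"
      using w i faces_subset_I assms unfolding cell_def by blast+
    with h i show "j \<in> S" by (metis DiffI linorder_not_less)
  qed
qed (auto simp: cell_def)

lemma simp_hull_subset_iff:
  assumes "S \<in> faces" "S' \<in> faces"
  shows "simp_hull b S \<subseteq> simp_hull b S' \<longleftrightarrow> S \<subseteq> S'"
proof
  assume sub: "simp_hull b S \<subseteq> simp_hull b S'"
  obtain \<sigma> where \<sigma>: "\<sigma> \<in> TS" "S' \<subseteq> \<sigma>" using assms(2) unfolding faces_def by blast
  show "S \<subseteq> S'"
  proof
    fix i assume i: "i \<in> S"
    then have "rvec (b i) \<in> simp_hull b S'"
      using sub unfolding simp_hull_def ptR_eq_rvec[symmetric] by (blast intro: hull_inc)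
    then have "b i \<in> b ` S'"
      using unimodular_vertex_in_face[OF unimodular[OF \<sigma>(1)] \<sigma>(2)] by blast
    then show "i \<in> S'"
      using inj_on_image_mem_iff[OF inj_b] i faces_subset_I assms by blast
  qed
qed (auto simp: simp_hull_def intro!: hull_mono)

text \<open>Both cones are cut out by
  \<open>ptR b i \<bullet> \<xi> \<le> ptR b j \<bullet> \<xi>\<close> for \<open>i\<close> in
  \<open>S\<close> and \<open>j\<close> in \<open>S'\<close>. Differences of cell points satisfy
  this by maximality. Conversely such a \<open>\<xi>\<close> leads, for a small step, from a
  relative interior point of \<open>cell S\<close> into \<open>cell S'\<close>.\<close>

lemma cone_duality:
  assumes "S \<in> faces" "S' \<in> faces" "S' \<subseteq> S"
  shows "cone_pair (cell S) (cell S') = dual_cone (cone_pair (simp_hull b S') (simp_hull b S))"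
proof (intro equalityI subsetI)
  fix \<xi> assume "\<xi> \<in> cone_pair (cell S) (cell S')"
  then obtain t x y where t: "\<xi> = t *\<^sub>R (x - y)" "x \<in> cell S'" "y \<in> cell S" "t \<ge> 0"
    unfolding cone_pair_def by blast
  obtain j0 where j0: "j0 \<in> S'" using assms(2) unfolding faces_def by blast
  have le: "ptR b i \<bullet> (x - y) \<le> ptR b j \<bullet> (x - y)" if "i \<in> S" "j \<in> S'" for i j
  proof -
    have "val i x \<le> val j x" "val j y \<le> val i y"
      using t(2,3) that assms faces_subset_I unfolding cell_def by blast+
    then show ?thesis by (simp add: val_def inner_diff_right)
  qed
  define c where "c = ptR b j0 \<bullet> (x - y)"
  have "simp_hull b S \<subseteq> {z. (x - y) \<bullet> z \<le> c}"
    unfolding simp_hull_def using le j0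
    by (intro hull_minimal convex_halfspace_le) (auto simp: c_def inner_commute)
  moreover have "simp_hull b S' \<subseteq> {z. (x - y) \<bullet> z \<ge> c}"
    unfolding simp_hull_def using le j0 assms(3)
    by (intro hull_minimal convex_halfspace_ge) (auto simp: c_def inner_commute)
  ultimately have sep: "(x - y) \<bullet> u \<le> (x - y) \<bullet> v" if "u \<in> simp_hull b S" "v \<in> simp_hull b S'" for u v
    using that by fastforce
  then show "\<xi> \<in> dual_cone (cone_pair (simp_hull b S') (simp_hull b S))"
    unfolding dual_cone_def t(1)
  proof (intro CollectI ballI)
    fix z assume "z \<in> cone_pair (simp_hull b S') (simp_hull b S)"
    then obtain r u v where z: "z = r *\<^sub>R (u - v)" "u \<in> simp_hull b S" "v \<in> simp_hull b S'" "r \<ge> 0"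
      unfolding cone_pair_def by blast
    have "(x - y) \<bullet> (u - v) \<le> 0" if "(x - y) \<bullet> u \<le> (x - y) \<bullet> v"
      using that by (simp only: inner_diff_right diff_le_0_iff_le)
    then have "t * (r * ((x - y) \<bullet> (u - v))) \<le> 0"
      using z sep t(4) by (simp only: mult_nonneg_nonpos)
    then show "(t *\<^sub>R (x - y)) \<bullet> z \<le> 0" unfolding z(1) by (simp add: mult.left_commute)
  qed
next
  fix \<xi> assume \<xi>: "\<xi> \<in> dual_cone (cone_pair (simp_hull b S') (simp_hull b S))"
  have le: "ptR b i \<bullet> \<xi> \<le> ptR b j \<bullet> \<xi>" if "i \<in> S" "j \<in> S'" for i j
  proof -
    have "ptR b i \<in> simp_hull b S" "ptR b j \<in> simp_hull b S'"
      using that unfolding simp_hull_def by (auto intro: hull_inc)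
    then have "1 *\<^sub>R (ptR b i - ptR b j) \<in> cone_pair (simp_hull b S') (simp_hull b S)"
      unfolding cone_pair_def by (intro CollectI exI[of _ 1] exI[of _ "ptR b i"] exI[of _ "ptR b j"]) auto
    then have "\<xi> \<bullet> (1 *\<^sub>R (ptR b i - ptR b j)) \<le> 0" using \<xi> unfolding dual_cone_def by blast
    then show ?thesis by (simp add: inner_diff_right inner_commute)
  qed
  obtain y h where h: "\<forall>i\<in>S. val i y = h" "\<forall>j\<in>I - S. val j y < h"
    using face_interior_point[OF assms(1)] by blast
  then have y: "y \<in> cell S" by (rule face_interior_point_in_cell[OF assms(1)])
  obtain j0 where j0: "j0 \<in> S'" using assms(2) unfolding faces_def by blast
  \<comment> \<open>On \<open>S'\<close> the functional has the constant value \<open>c\<close>, and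
    \<open>c\<close> bounds it on \<open>S\<close>; only indices outside \<open>S\<close> limit the
    step length.\<close>
  define c where "c = ptR b j0 \<bullet> \<xi>"
  obtain \<epsilon> where \<epsilon>: "\<epsilon> > 0" "\<forall>j\<in>I - S. \<epsilon> * (ptR b j \<bullet> \<xi> - c) < h - val j y"
    using finite_small_positive[of "I - S" "\<lambda>j. h - val j y" "\<lambda>j. ptR b j \<bullet> \<xi> - c"] finite_I h(2) by auto
  have v: "val j (y + \<epsilon> *\<^sub>R \<xi>) = val j y + \<epsilon> * (ptR b j \<bullet> \<xi> - c) + \<epsilon> * c" for j
    by (simp add: val_def inner_add_right algebra_simps)
  have top: "val j (y + \<epsilon> *\<^sub>R \<xi>) = h + \<epsilon> * c" if "j \<in> S'" for j
  proof -
    have "ptR b j \<bullet> \<xi> = c" using le that j0 assms(3) by (auto simp: c_def intro: antisym)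
    then show ?thesis unfolding v using h(1) that assms(3) by auto
  qed
  have below: "val j (y + \<epsilon> *\<^sub>R \<xi>) \<le> h + \<epsilon> * c" if "j \<in> I" for j
  proof (cases "j \<in> S")
    case True
    then have "\<epsilon> * (ptR b j \<bullet> \<xi> - c) \<le> 0"
      using le j0 \<epsilon>(1) by (simp add: c_def mult_nonneg_nonpos)
    then show ?thesis unfolding v using h(1) True by simp
  next
    case False
    then have "\<epsilon> * (ptR b j \<bullet> \<xi> - c) < h - val j y" using \<epsilon>(2) that by blast
    then show ?thesis unfolding v by linarith
  qed
  have "y + \<epsilon> *\<^sub>R \<xi> \<in> cell S'"
    unfolding cell_def using top below by simp
  then show "\<xi> \<in> cone_pair (cell S) (cell S')"
    unfolding cone_pair_def using y \<epsilon>(1)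
    by (intro CollectI exI[of _ "1/\<epsilon>"] exI[of _ "y + \<epsilon> *\<^sub>R \<xi>"] exI[of _ y]) auto
qed

lemma spine_cells_eq:
  assumes H: "comp_affine H = (\<lambda>i. (\<tau> i, ptR b i)) ` I"
  shows "spine_cells H = cell ` faces"
proof -
  have spine_max: "spine_fun H w = Max ((\<lambda>i. val i w) ` I)" if "I \<noteq> {}" for w
    unfolding spine_fun_def H image_image
    using finite_I that by (simp add: val_def cSup_eq_Max)
  have region: "spine_region H (\<tau> i, ptR b i) = {w. \<forall>j\<in>I. val j w \<le> val i w}" if i: "i \<in> I" for i
  proof -
    have ne: "I \<noteq> {}" using i by blast
    have iff: "val i w = Max ((\<lambda>i. val i w) ` I) \<longleftrightarrow> (\<forall>j\<in>I. val j w \<le> val i w)" for w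
      using finite_I i by (subst eq_commute, subst Max_eq_iff) auto
    show ?thesis
      unfolding spine_region_def fst_conv snd_conv val_def[symmetric] spine_max[OF ne] iff by (rule refl)
  qed
  have inter: "(\<Inter>f\<in>(\<lambda>i. (\<tau> i, ptR b i)) ` S. spine_region H f) = cell S" if "S \<subseteq> I" for S
    using region that unfolding cell_def by (auto simp: subset_iff)
  show ?thesis
  proof (intro equalityI subsetI)
    fix X assume "X \<in> spine_cells H"
    then obtain G where G: "X \<noteq> {}" "G \<subseteq> comp_affine H" "G \<noteq> {}" "X = (\<Inter>f\<in>G. spine_region H f)"
      unfolding spine_cells_def by blast
    then obtain S where S: "S \<subseteq> I" "G = (\<lambda>i. (\<tau> i, ptR b i)) ` S"
      unfolding H by (auto simp: subset_image_iff)
    then have "X = cell S" "S \<noteq> {}" using G inter by auto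
    then show "X \<in> cell ` faces" using cell_nonempty_imp_face[of _ S] G(1) S(1) by blast
  next
    fix X assume "X \<in> cell ` faces"
    then obtain S where S: "S \<in> faces" "X = cell S" by blast
    have "X \<noteq> {}" using face_interior_point[OF S(1)] face_interior_point_in_cell[OF S(1)] S(2) by blast
    moreover have "S \<noteq> {}" using S(1) unfolding faces_def by blast
    ultimately show "X \<in> spine_cells H"
      unfolding spine_cells_def H using inter[OF faces_subset_I[OF S(1)]] S(2) faces_subset_I[OF S(1)]
      by (intro CollectI conjI exI[of _ "(\<lambda>i. (\<tau> i, ptR b i)) ` S"]) auto
  qed
qed

text \<open>Cells and simplices are both parametrised injectively and with known inclusions by
  \<open>faces\<close>; the duality map passes through this common index set.\<close>

theorem dual_subdivisions_spine_cells:
  assumes H: "comp_affine H = (\<lambda>i. (\<tau> i, ptR b i)) ` I"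
  shows "dual_subdivisions (spine_cells H) (tri_cells b TS)"
proof -
  have tri: "tri_cells b TS = simp_hull b ` faces"
    unfolding tri_cells_def faces_def by blast
  have inj: "inj_on cell faces" "inj_on (simp_hull b) faces"
    using cell_subset_iff simp_hull_subset_iff by (auto simp: inj_on_def set_eq_subset)
  define \<phi> where "\<phi> = simp_hull b \<circ> the_inv_into faces cell"
  have \<phi>: "\<phi> (cell S) = simp_hull b S" if "S \<in> faces" for S
    using the_inv_into_f_f[OF inj(1) that] by (simp add: \<phi>_def)
  have "bij_betw \<phi> (cell ` faces) (simp_hull b ` faces)"
    unfolding \<phi>_def using inj
    by (intro bij_betw_trans[OF bij_betw_the_inv_into]) (auto simp: bij_betw_def)
  then show ?thesis
    unfolding dual_subdivisions_def spine_cells_eq[OF H] tri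
    by (intro exI[of _ \<phi>]) (auto simp: \<phi> cell_subset_iff simp_hull_subset_iff cone_duality)
qed

end

section \<open>The gap coming from the classes\<close>

text \<open>Gaussian elimination: an unknown \<open>k0\<close> with nonzero coefficient in equation
  \<open>x\<close> is solved for and substituted into the others.\<close>

lemma underdetermined_homogeneous_system:
  fixes A :: "'a \<Rightarrow> 'b \<Rightarrow> real"
  assumes "finite J" "finite K" "card J < card K"
  shows "\<exists>c. (\<forall>j\<in>J. (\<Sum>k\<in>K. c k * A k j) = 0) \<and> (\<exists>k\<in>K. c k \<noteq> 0)"
  using assms
proof (induction J arbitrary: K A rule: finite_induct)
  case empty
  then obtain k where "k \<in> K" by fastforce
  then show ?case by (intro exI[of _ "\<lambda>_. 1"]) auto
next
  case (insert x J)
  show ?case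
  proof (cases "\<forall>k\<in>K. A k x = 0")
    case True
    have "card J < card K" using insert by simp
    then obtain c where "\<forall>j\<in>J. (\<Sum>k\<in>K. c k * A k j) = 0" "\<exists>k\<in>K. c k \<noteq> 0"
      using insert.IH insert.prems(1) by blast
    with True show ?thesis by (intro exI[of _ c]) auto
  next
    case False
    then obtain k0 where k0: "k0 \<in> K" "A k0 x \<noteq> 0" by blast
    define K' where "K' = K - {k0}"
    have "card J < card K'" "finite K'" using insert k0 by (auto simp: K'_def)
    then obtain c where c: "\<forall>j\<in>J. (\<Sum>k\<in>K'. c k * (A k j - A k x / A k0 x * A k0 j)) = 0" "\<exists>k\<in>K'. c k \<noteq> 0"
      using insert.IH[of K' "\<lambda>k j. A k j - A k x / A k0 x * A k0 j"] by blast
    \<comment> \<open>Giving the eliminated unknown the value \<open>- S\<close> solves equation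
      \<open>x\<close>.\<close>
    define S where "S = (\<Sum>k\<in>K'. c k * A k x) / A k0 x"
    define c' where "c' k = (if k = k0 then - S else c k)" for k
    have split: "(\<Sum>k\<in>K. c' k * f k) = - S * f k0 + (\<Sum>k\<in>K'. c k * f k)" for f
      using insert.prems(1) k0(1) unfolding K'_def
      by (subst sum.remove[of K k0]) (auto simp: c'_def intro!: sum.cong)
    have "(\<Sum>k\<in>K. c' k * A k x) = 0"
      unfolding split using k0(2) by (simp add: S_def)
    moreover have "(\<Sum>k\<in>K. c' k * A k j) = 0" if "j \<in> J" for j
    proof -
      have "(\<Sum>k\<in>K'. c k * (A k j - A k x / A k0 x * A k0 j)) =
          (\<Sum>k\<in>K'. c k * A k j) - (\<Sum>k\<in>K'. c k * A k x * (A k0 j / A k0 x))"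
        by (simp add: right_diff_distrib sum_subtractf mult.assoc)
      also have "(\<Sum>k\<in>K'. c k * A k x * (A k0 j / A k0 x)) = S * A k0 j"
        unfolding sum_distrib_right[symmetric] by (simp add: S_def)
      finally show ?thesis unfolding split using c(1) that by simp
    qed
    moreover have "\<exists>k\<in>K. c' k \<noteq> 0"
      using c(2) by (auto simp: c'_def K'_def)
    ultimately show ?thesis by blast
  qed
qed

lemma unimodular_triangle_card: "unimodular_triangle b \<sigma> \<Longrightarrow> card \<sigma> = 3"
  unfolding unimodular_triangle_def by (auto simp: card_insert_if algebra_simps)

definition barycentric :: "(nat \<Rightarrow> int \<times> int) \<Rightarrow> nat set \<Rightarrow> int \<times> int \<Rightarrow> (nat \<Rightarrow> int) \<Rightarrow> bool" where
  "barycentric b \<sigma> z \<mu> \<longleftrightarrow> (\<Sum>i\<in>\<sigma>. \<mu> i) = 1 \<and>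
     (\<Sum>i\<in>\<sigma>. \<mu> i * fst (b i)) = fst z \<and> (\<Sum>i\<in>\<sigma>. \<mu> i * snd (b i)) = snd z"

text \<open>Adding a linear function that makes \<open>v\<close> constant on the triangle turns the
  defect of \<open>v j\<close> from its interpolation into the distance below that constant.
  \<open>M\<close> may depend on \<open>j\<close>, as needed for the perturbed heights.\<close>

lemma triangle_vertex_with_gap:
  assumes uni: "unimodular_triangle b \<sigma>"
    and gap: "\<And>j. j \<in> J \<Longrightarrow> barycentric b \<sigma> (b j) (\<mu> j) \<and> v j - (\<Sum>i\<in>\<sigma>. real_of_int (\<mu> j i) * v i) \<le> - M j"
  shows "\<exists>w h. (\<forall>i\<in>\<sigma>. v i + ptR b i \<bullet> w = h) \<and> (\<forall>j\<in>J. v j + ptR b j \<bullet> w \<le> h - M j)"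
proof -
  obtain w c where wc: "\<forall>i\<in>\<sigma>. ptR b i \<bullet> w + c = - v i"
    using unimodular_affine_interpolation[OF uni, of "\<lambda>i. - v i"] by blast
  then have h: "v i + ptR b i \<bullet> w = - c" if "i \<in> \<sigma>" for i using that by force
  have "v j + ptR b j \<bullet> w \<le> - c - M j" if j: "j \<in> J" for j
  proof -
    have bary: "barycentric b \<sigma> (b j) (\<mu> j)" using gap[OF j] by blast
    have "(\<Sum>i\<in>\<sigma>. real_of_int (\<mu> j i) * (v i + ptR b i \<bullet> w)) = (\<Sum>i\<in>\<sigma>. real_of_int (\<mu> j i)) * (- c)"
      unfolding sum_distrib_right using h by (intro sum.cong) auto
    also have "(\<Sum>i\<in>\<sigma>. real_of_int (\<mu> j i)) = 1"
      using bary unfolding barycentric_def of_int_sum[symmetric] by simp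
    also have "(\<Sum>i\<in>\<sigma>. real_of_int (\<mu> j i) * (v i + ptR b i \<bullet> w))
      = (\<Sum>i\<in>\<sigma>. real_of_int (\<mu> j i) * v i) + (\<Sum>i\<in>\<sigma>. real_of_int (\<mu> j i) * (ptR b i \<bullet> w))"
      by (simp add: distrib_left sum.distrib)
    also have "(\<Sum>i\<in>\<sigma>. real_of_int (\<mu> j i) * (ptR b i \<bullet> w)) = ptR b j \<bullet> w"
      using bary barycentric_ptR[of "\<mu> j" b \<sigma> "b j" w] unfolding barycentric_def ptR_eq_rvec by blast
    finally show ?thesis using gap[OF j] by simp
  qed
  with h show ?thesis by blast
qed

text \<open>A zero column would leave at most \<open>p - 1\<close> equations on \<open>p\<close>
  unknowns, hence a nontrivial relation among the rows of a nondegenerate matrix.\<close>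

lemma kahler_column_nonzero:
  assumes "toric_data b p TS" "kahler_data b p TS s" "\<sigma> \<in> TS" "j \<in> idx p - \<sigma>"
  shows "\<exists>k\<in>{1..p}. s \<sigma> k j \<noteq> 0"
proof (rule ccontr)
  assume zero: "\<not> (\<exists>k\<in>{1..p}. s \<sigma> k j \<noteq> 0)"
  have \<sigma>: "\<sigma> \<subseteq> idx p" "unimodular_triangle b \<sigma>"
    using assms(1,3) unfolding toric_data_def by blast+
  have fin: "finite (idx p)" "card (idx p) = p + 3" by (auto simp: idx_def)
  have "card (idx p - \<sigma>) = p"
    using \<sigma> fin unimodular_triangle_card[OF \<sigma>(2)] unimodular_triangle_finite[OF \<sigma>(2)]
    by (simp add: card_Diff_subset)
  then have "card (idx p - \<sigma> - {j}) < card {1..p}"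
    using assms(4) fin by (metis card_Diff1_less card_atLeastAtMost diff_Suc_1 finite_Diff)
  then obtain c where c: "\<forall>i\<in>idx p - \<sigma> - {j}. (\<Sum>k\<in>{1..p}. c k * real (s \<sigma> k i)) = 0" "\<exists>k\<in>{1..p}. c k \<noteq> 0"
    using underdetermined_homogeneous_system[of "idx p - \<sigma> - {j}" "{1..p}" "\<lambda>k i. real (s \<sigma> k i)"] fin by auto
  have "(\<Sum>k\<in>{1..p}. c k * real (s \<sigma> k j)) = 0" using zero by simp
  with c(1) have "\<forall>i\<in>idx p - \<sigma>. (\<Sum>k\<in>{1..p}. c k * real (s \<sigma> k i)) = 0" by blast
  then have "\<forall>k\<in>{1..p}. c k = 0"
    using assms(2,3) unfolding kahler_data_def by blast
  with c(2) show False by blast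
qed

text \<open>The vector \<open>l\<close> is \<open>e_j\<close> minus the barycentric combination of
  the corners, an element of \<open>L\<close>. Outside \<open>\<sigma>\<close> it is supported at
  \<open>j\<close> alone, so the expansion of the class with respect to \<open>\<sigma>\<close>
  leaves one coefficient.\<close>

lemma kahler_relation:
  assumes "toric_data b p TS" "kahler_data b p TS s" "\<sigma> \<in> TS" and j: "j \<in> idx p - \<sigma>"
    and bary: "barycentric b \<sigma> (b j) \<mu>" and k: "k \<in> {1..p}"
  defines "l \<equiv> (\<lambda>x. if x = j then 1 else if x \<in> \<sigma> then - \<mu> x else 0)"
  shows "(\<Sum>x\<in>idx p - {1,2,3}. int (s {1,2,3} k x) * l x) = int (s \<sigma> k j)"
proof -
  have \<sigma>: "\<sigma> \<subseteq> idx p" using assms(1,3) unfolding toric_data_def by blast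
  have fin: "finite (idx p)" by (simp add: idx_def)
  have sum_l: "(\<Sum>x\<in>idx p. l x * f x) = f j - (\<Sum>x\<in>\<sigma>. \<mu> x * f x)" for f :: "nat \<Rightarrow> int"
  proof -
    have "(\<Sum>x\<in>idx p. l x * f x) = (\<Sum>x\<in>idx p - \<sigma>. l x * f x) + (\<Sum>x\<in>\<sigma>. l x * f x)"
      using sum.subset_diff[OF \<sigma> fin] .
    also have "(\<Sum>x\<in>idx p - \<sigma>. l x * f x) = (\<Sum>x\<in>idx p - \<sigma>. if x = j then f x else 0)"
      by (intro sum.cong) (auto simp: l_def)
    also have "(\<Sum>x\<in>\<sigma>. l x * f x) = (\<Sum>x\<in>\<sigma>. - (\<mu> x * f x))"
      using j by (intro sum.cong) (auto simp: l_def)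
    finally show ?thesis using j fin by (simp add: sum_negf)
  qed
  have "inL b p l"
    unfolding inL_def sum_l using sum_l[of "\<lambda>_. 1"] bary j \<sigma>
    by (auto simp: barycentric_def l_def)
  then have "(\<Sum>x\<in>idx p - \<sigma>. int (s \<sigma> k x) * l x) = (\<Sum>x\<in>idx p - {1,2,3}. int (s {1,2,3} k x) * l x)"
    using assms(2,3) k unfolding kahler_data_def by blast
  moreover have "(\<Sum>x\<in>idx p - \<sigma>. int (s \<sigma> k x) * l x) = (\<Sum>x\<in>idx p - \<sigma>. if x = j then int (s \<sigma> k x) else 0)"
    by (intro sum.cong) (auto simp: l_def)
  ultimately show ?thesis using j fin by simp
qed

lemma ln_norm_coef_a:
  assumes "\<forall>k\<in>{1..p}. q k \<noteq> 0"
  shows "ln (cmod (coef_a s p q i)) = (if i \<le> 3 then 0 else (\<Sum>k\<in>{1..p}. real (s {1,2,3} k i) * ln (cmod (q k))))"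
proof -
  have "ln (\<Prod>k\<in>{1..p}. cmod (q k) ^ s {1,2,3} k i) = (\<Sum>k\<in>{1..p}. ln (cmod (q k) ^ s {1,2,3} k i))"
    using assms by (intro ln_prod) auto
  then show ?thesis
    using assms by (simp add: coef_a_def norm_power ln_realpow flip: prod_norm)
qed

text \<open>The relation in \<open>L\<close> expressing \<open>b j\<close> through the vertices of \<open>\<sigma>\<close> pairs to \<open>s \<sigma> k j\<close> with the
  \<open>k\<close>-th class, so \<open>ln \<bar>a j\<bar>\<close> lies below the affine interpolation from \<open>\<sigma>\<close>, by an amount growing with
  \<open>- ln \<bar>q k\<bar>\<close>.\<close>

lemma kahler_gap:
  assumes "toric_data b p TS" "kahler_data b p TS s" "\<sigma> \<in> TS" and j: "j \<in> idx p - \<sigma>"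
    and bary: "barycentric b \<sigma> (b j) \<mu>"
    and q: "\<forall>k\<in>{1..p}. q k \<noteq> 0 \<and> cmod (q k) < exp (- M)" and M: "M > 0"
  defines "u \<equiv> \<lambda>i. ln (cmod (coef_a s p q i))"
  shows "u j - (\<Sum>i\<in>\<sigma>. real_of_int (\<mu> i) * u i) \<le> - M"
proof -
  have \<sigma>: "\<sigma> \<subseteq> idx p" using assms(1,3) unfolding toric_data_def by blast
  have fin: "finite (idx p)" by (simp add: idx_def)
  define l where "l x = (if x = j then 1 else if x \<in> \<sigma> then - \<mu> x else 0)" for x
  have r: "ln (cmod (q k)) < - M" if "k \<in> {1..p}" for k
    using q that by (metis exp_less_cancel_iff exp_ln zero_less_norm_iff)
  have u0: "u x = 0" if "x \<in> {1,2,3}" for x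
    using that q by (auto simp: u_def ln_norm_coef_a)
  have u1: "u x = (\<Sum>k\<in>{1..p}. real (s {1,2,3} k x) * ln (cmod (q k)))" if "x \<in> idx p - {1,2,3}" for x
    using that q by (auto simp: u_def ln_norm_coef_a idx_def)
  have 1: "(\<Sum>x\<in>idx p. real_of_int (l x) * u x) = u j - (\<Sum>i\<in>\<sigma>. real_of_int (\<mu> i) * u i)"
  proof -
    have "(\<Sum>x\<in>idx p. real_of_int (l x) * u x) = (\<Sum>x\<in>idx p - \<sigma>. real_of_int (l x) * u x) + (\<Sum>x\<in>\<sigma>. real_of_int (l x) * u x)"
      using sum.subset_diff[OF \<sigma> fin] .
    also have "(\<Sum>x\<in>idx p - \<sigma>. real_of_int (l x) * u x) = (\<Sum>x\<in>idx p - \<sigma>. if x = j then u x else 0)"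
      by (intro sum.cong) (auto simp: l_def)
    also have "(\<Sum>x\<in>\<sigma>. real_of_int (l x) * u x) = (\<Sum>x\<in>\<sigma>. - (real_of_int (\<mu> x) * u x))"
      using j by (intro sum.cong) (auto simp: l_def)
    finally show ?thesis using j fin by (simp add: sum_negf)
  qed
  \<comment> \<open>The three normalised coefficients are 1 and have logarithm 0, so the sum reduces
    to the indices carrying the expansion at \<open>{1,2,3}\<close>.\<close>
  have "{1,2,3} \<subseteq> idx p" by (auto simp: idx_def)
  then have "(\<Sum>x\<in>idx p. real_of_int (l x) * u x) = (\<Sum>x\<in>idx p - {1,2,3}. real_of_int (l x) * u x)"
    using fin u0 by (intro sum.mono_neutral_right) auto
  also have "\<dots> = (\<Sum>x\<in>idx p - {1,2,3}. \<Sum>k\<in>{1..p}. real_of_int (int (s {1,2,3} k x) * l x) * ln (cmod (q k)))"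
    using u1 by (intro sum.cong) (simp_all add: sum_distrib_left mult_ac)
  also have "\<dots> = (\<Sum>k\<in>{1..p}. real_of_int (\<Sum>x\<in>idx p - {1,2,3}. int (s {1,2,3} k x) * l x) * ln (cmod (q k)))"
    by (subst sum.swap) (simp add: sum_distrib_right)
  also have "\<dots> = (\<Sum>k\<in>{1..p}. real (s \<sigma> k j) * ln (cmod (q k)))"
    using kahler_relation[OF assms(1-3) j bary] unfolding l_def by (intro sum.cong) auto
  also have "\<dots> \<le> - M"
  proof -
    \<comment> \<open>All summands are nonpositive since \<open>cmod (q k) < 1\<close>; one has
      multiplicity at least 1 and alone contributes at most \<open>- M\<close>.\<close>
    obtain k0 where k0: "k0 \<in> {1..p}" "s \<sigma> k0 j \<noteq> 0"
      using kahler_column_nonzero[OF assms(1-3) j] by blast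
    have neg: "real (s \<sigma> k j) * ln (cmod (q k)) \<le> 0" if "k \<in> {1..p}" for k
      using r[OF that] M by (intro mult_nonneg_nonpos) auto
    have "(\<Sum>k\<in>{1..p}. real (s \<sigma> k j) * ln (cmod (q k))) =
       real (s \<sigma> k0 j) * ln (cmod (q k0)) + (\<Sum>k\<in>{1..p} - {k0}. real (s \<sigma> k j) * ln (cmod (q k)))"
      using k0 by (intro sum.remove) auto
    also have "\<dots> \<le> real (s \<sigma> k0 j) * ln (cmod (q k0)) + 0"
      using neg by (intro add_left_mono sum_nonpos) auto
    also have "\<dots> \<le> 1 * ln (cmod (q k0)) + 0"
      using r[OF k0(1)] k0(2) M by (intro add_right_mono mult_right_mono_neg) auto
    finally show ?thesis using r[OF k0(1)] by simp
  qed
  finally show ?thesis using 1 by simp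
qed

section \<open>Choice of the scale and conclusion\<close>

text \<open>From the vertex dual to a triangle with corner \<open>i\<close>, a fixed shift
  \<open>d\<close> lifts monomial \<open>i\<close> above the other corners; a large gap keeps
  everything else below. Heights are quantified after \<open>M\<close>, so the threshold is uniform
  in \<open>q\<close>.\<close>

lemma dominant_monomial_exists:
  assumes uni: "unimodular_triangle b \<sigma>" and fin: "finite I" and i: "i \<in> \<sigma>" "i \<in> I"
  shows "\<forall>\<^sub>F M in at_top. \<forall>v \<mu>.
     (\<forall>j\<in>I - \<sigma>. barycentric b \<sigma> (b j) (\<mu> j) \<and> v j - (\<Sum>i\<in>\<sigma>. real_of_int (\<mu> j i) * v i) \<le> - M) \<longrightarrow>
     (\<exists>w. (\<Sum>j\<in>I - {i}. exp (v j) * exp (ptR b j \<bullet> w)) \<le> exp (v i) * exp (ptR b i \<bullet> w) / 2)"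
proof -
  \<comment> \<open>With this margin each competitor is at most \<open>1 / (2 * card I)\<close> of
    monomial \<open>i\<close>, so all together are at most one half.\<close>
  define K where "K = ln (2 * real (card I))"
  have card: "real (card I) > 0" using fin i by (auto simp: card_gt_0_iff)
  obtain d c where dc: "\<forall>j\<in>\<sigma>. ptR b j \<bullet> d + c = (if j = i then K else 0)"
    using unimodular_affine_interpolation[OF uni, of "\<lambda>j. if j = i then K else 0"] by blast
  \<comment> \<open>The shift \<open>d\<close> can bring an index outside the triangle closer to
    \<open>i\<close> by at most \<open>M0 - K\<close>; a gap of \<open>M0\<close> leaves the margin
    \<open>K\<close>.\<close>
  define M0 where "M0 = Max ((\<lambda>j. K + (ptR b j - ptR b i) \<bullet> d) ` I)"
  show ?thesis
    using eventually_ge_at_top[of M0]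
  proof (eventually_elim, intro allI impI)
    fix M v \<mu>
    assume M: "M0 \<le> M"
      and gap: "\<forall>j\<in>I - \<sigma>. barycentric b \<sigma> (b j) (\<mu> j) \<and> v j - (\<Sum>i\<in>\<sigma>. real_of_int (\<mu> j i) * v i) \<le> - M"
    obtain w0 h where h: "\<forall>l\<in>\<sigma>. v l + ptR b l \<bullet> w0 = h" "\<forall>j\<in>I - \<sigma>. v j + ptR b j \<bullet> w0 \<le> h - M"
      using triangle_vertex_with_gap[OF uni, of "I - \<sigma>" \<mu> v "\<lambda>_. M"] gap by blast
    define w where "w = w0 + d"
    have "v j + ptR b j \<bullet> w \<le> v i + ptR b i \<bullet> w - K" if j: "j \<in> I - {i}" for j
    proof (cases "j \<in> \<sigma>")
      case True
      then have "v j + ptR b j \<bullet> w0 = h" "ptR b j \<bullet> d + c = 0" "v i + ptR b i \<bullet> w0 = h" "ptR b i \<bullet> d + c = K"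
        using h(1) dc i j by auto
      then show ?thesis by (simp add: w_def inner_add_right)
    next
      case False
      have "K + (ptR b j - ptR b i) \<bullet> d \<le> M0"
        unfolding M0_def using fin j by (intro Max_ge) auto
      moreover have "v j + ptR b j \<bullet> w0 \<le> h - M" "v i + ptR b i \<bullet> w0 = h"
        using h i j False by auto
      ultimately show ?thesis using M by (simp add: w_def inner_add_right inner_diff_left)
    qed
    then have "exp (v j + ptR b j \<bullet> w) \<le> exp (v i + ptR b i \<bullet> w - K)" if "j \<in> I - {i}" for j
      using that by simp
    moreover have "exp (v i + ptR b i \<bullet> w - K) = exp (v i) * exp (ptR b i \<bullet> w) / (2 * real (card I))"
      using card by (simp add: exp_diff exp_add K_def)
    ultimately have "(\<Sum>j\<in>I - {i}. exp (v j) * exp (ptR b j \<bullet> w)) \<le>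
        real (card (I - {i})) * (exp (v i) * exp (ptR b i \<bullet> w) / (2 * real (card I)))"
      by (intro sum_bounded_above) (simp add: exp_add)
    also have "\<dots> \<le> real (card I) * (exp (v i) * exp (ptR b i \<bullet> w) / (2 * real (card I)))"
      using fin by (intro mult_right_mono) (auto intro: card_mono)
    also have "\<dots> = exp (v i) * exp (ptR b i \<bullet> w) / 2" using card by simp
    finally show "\<exists>w. (\<Sum>j\<in>I - {i}. exp (v j) * exp (ptR b j \<bullet> w)) \<le> exp (v i) * exp (ptR b i \<bullet> w) / 2"
      by blast
  qed
qed

lemma toric_data_regular_triangulation:
  assumes "toric_data b p TS"
    and "\<And>\<sigma>. \<sigma> \<in> TS \<Longrightarrow> \<exists>w h. (\<forall>i\<in>\<sigma>. \<tau> i + ptR b i \<bullet> w = h) \<and> (\<forall>j\<in>idx p - \<sigma>. \<tau> j + ptR b j \<bullet> w < h)"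
  shows "regular_triangulation b (idx p) TS \<tau>"
  using assms unfolding toric_data_def polygon_def
  by unfold_locales (auto simp: idx_def)

theorem theorem3p4:
  fixes b :: "nat \<Rightarrow> int \<times> int" and p :: nat and TS :: "nat set set"
    and s :: "nat set \<Rightarrow> nat \<Rightarrow> nat \<Rightarrow> nat"
  assumes "toric_data b p TS"
    and "kahler_data b p TS s"
  shows "\<exists>\<epsilon>>0. \<forall>q :: nat \<Rightarrow> complex.
           (\<forall>k\<in>{1..p}. q k \<noteq> 0 \<and> cmod (q k) < \<epsilon>) \<longrightarrow>
           dual_subdivisions (spine_cells (mirrorH b p s q)) (tri_cells b TS)"
proof -
  define I where "I = idx p"
  have fin: "finite I" "finite TS" using assms(1) by (auto simp: I_def idx_def toric_data_def)
  have uni: "unimodular_triangle b \<sigma>" if "\<sigma> \<in> TS" for \<sigma>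
    using assms(1) that unfolding toric_data_def by blast
  have "\<exists>\<mu>. barycentric b \<sigma> (b j) \<mu>" if "\<sigma> \<in> TS" for \<sigma> j
    using unimodular_barycentric[OF uni[OF that]] unfolding barycentric_def by blast
  then obtain \<mu> where \<mu>: "\<And>\<sigma> j. \<sigma> \<in> TS \<Longrightarrow> barycentric b \<sigma> (b j) (\<mu> \<sigma> j)" by metis
  have "\<Union>TS = I" using assms(1) by (simp add: toric_data_def I_def)
  then have "\<exists>\<sigma>\<in>TS. i \<in> \<sigma>" if "i \<in> I" for i using that by blast
  then obtain tri where tri: "\<And>i. i \<in> I \<Longrightarrow> tri i \<in> TS \<and> i \<in> tri i" by metis
  have dom: "\<forall>\<^sub>F M in at_top. \<forall>v \<mu>.
     (\<forall>j\<in>I - tri i. barycentric b (tri i) (b j) (\<mu> j) \<and> v j - (\<Sum>l\<in>tri i. real_of_int (\<mu> j l) * v l) \<le> - M) \<longrightarrow>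
     (\<exists>w. (\<Sum>j\<in>I - {i}. exp (v j) * exp (ptR b j \<bullet> w)) \<le> exp (v i) * exp (ptR b i \<bullet> w) / 2)" if "i \<in> I" for i
    using dominant_monomial_exists[OF uni fin(1) _ that] tri[OF that] by blast
  have "\<forall>\<^sub>F M in at_top. 0 < M \<and> (\<forall>i\<in>I. (\<forall>v \<mu>.
     (\<forall>j\<in>I - tri i. barycentric b (tri i) (b j) (\<mu> j) \<and> v j - (\<Sum>l\<in>tri i. real_of_int (\<mu> j l) * v l) \<le> - M) \<longrightarrow>
     (\<exists>w. (\<Sum>j\<in>I - {i}. exp (v j) * exp (ptR b j \<bullet> w)) \<le> exp (v i) * exp (ptR b i \<bullet> w) / 2))) \<and>
      (\<forall>\<sigma>\<in>TS. \<forall>j\<in>I. ln 2 * (1 + (\<Sum>i\<in>\<sigma>. \<bar>real_of_int (\<mu> \<sigma> j i)\<bar>)) < M)"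
    using fin by (intro eventually_conj eventually_ball_finite ballI dom eventually_gt_at_top)
  then have "\<exists>M. 0 < M \<and> (\<forall>i\<in>I. \<forall>v \<mu>.
     (\<forall>j\<in>I - tri i. barycentric b (tri i) (b j) (\<mu> j) \<and> v j - (\<Sum>l\<in>tri i. real_of_int (\<mu> j l) * v l) \<le> - M) \<longrightarrow>
     (\<exists>w. (\<Sum>j\<in>I - {i}. exp (v j) * exp (ptR b j \<bullet> w)) \<le> exp (v i) * exp (ptR b i \<bullet> w) / 2)) \<and>
      (\<forall>\<sigma>\<in>TS. \<forall>j\<in>I. ln 2 * (1 + (\<Sum>i\<in>\<sigma>. \<bar>real_of_int (\<mu> \<sigma> j i)\<bar>)) < M)"
    by (rule eventually_happens'[OF trivial_limit_at_top_linorder])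
  \<comment> \<open>The second condition provides dominance of every monomial, the third lets the
    gap absorb the error ln 2 at \<open>j\<close> and at the corners of the triangle, weighted by
    their coordinates.\<close>
  then obtain M where M: "0 < M"
    "\<forall>i\<in>I. \<forall>v \<mu>.
     (\<forall>j\<in>I - tri i. barycentric b (tri i) (b j) (\<mu> j) \<and> v j - (\<Sum>l\<in>tri i. real_of_int (\<mu> j l) * v l) \<le> - M) \<longrightarrow>
     (\<exists>w. (\<Sum>j\<in>I - {i}. exp (v j) * exp (ptR b j \<bullet> w)) \<le> exp (v i) * exp (ptR b i \<bullet> w) / 2)"
    "\<forall>\<sigma>\<in>TS. \<forall>j\<in>I. ln 2 * (1 + (\<Sum>i\<in>\<sigma>. \<bar>real_of_int (\<mu> \<sigma> j i)\<bar>)) < M"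
    by (elim exE conjE) (rule that)
  have "dual_subdivisions (spine_cells (mirrorH b p s q)) (tri_cells b TS)"
    if q: "\<forall>k\<in>{1..p}. q k \<noteq> 0 \<and> cmod (q k) < exp (- M)" for q :: "nat \<Rightarrow> complex"
  proof -
    define a where "a = coef_a s p q"
    define u where "u i = ln (cmod (a i))" for i
    have a: "a i \<noteq> 0" for i using q by (auto simp: a_def coef_a_def)
    have exp_u: "exp (u i) = cmod (a i)" for i using a by (simp add: u_def)
    have gap: "u j - (\<Sum>i\<in>\<sigma>. real_of_int (\<mu> \<sigma> j i) * u i) \<le> - M" if "\<sigma> \<in> TS" "j \<in> I - \<sigma>" for \<sigma> j
      using kahler_gap[OF assms that(1) _ \<mu>[OF that(1)] q M(1)] that(2) unfolding u_def a_def I_def by blast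
    interpret laurent I a b by unfold_locales (rule fin)
    have H: "H = mirrorH b p s q"
      unfolding mirrorH_def H_def [abs_def] unfolding I_def a_def ..
    have "\<exists>\<tau>. comp_affine H = (\<lambda>i. (\<tau> i, rvec (b i))) ` I \<and> (\<forall>i\<in>I. \<bar>\<tau> i - ln (cmod (a i))\<bar> \<le> ln 2)"
    proof (rule comp_affine_eq)
      fix n assume "rvec n \<in> convex hull (\<lambda>i. rvec (b i)) ` I"
      then have "(real_of_int (fst n), real_of_int (snd n)) \<in> polygon b p"
        unfolding polygon_def I_def ptR_eq_rvec rvec_def .
      then show "n \<in> b ` I"
        using assms(1) unfolding toric_data_def I_def by blast
    next
      fix i assume i: "i \<in> I"
      then show "\<exists>w. (\<Sum>j\<in>I - {i}. cmod (a j) * exp (rvec (b j) \<bullet> w)) \<le> cmod (a i) * exp (rvec (b i) \<bullet> w) / 2"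
        using M(2)[rule_format, OF i, of "\<mu> (tri i)" u] gap \<mu> tri[OF i]
        unfolding exp_u ptR_eq_rvec by blast
    qed (rule a)
    then obtain \<tau> where \<tau>: "comp_affine H = (\<lambda>i. (\<tau> i, ptR b i)) ` I" "\<And>i. i \<in> I \<Longrightarrow> \<bar>\<tau> i - u i\<bar> \<le> ln 2"
      unfolding ptR_eq_rvec u_def by blast
    have "regular_triangulation b (idx p) TS \<tau>"
    proof (rule toric_data_regular_triangulation[OF assms(1)])
      fix \<sigma> assume \<sigma>: "\<sigma> \<in> TS"
      then have sub: "\<sigma> \<subseteq> I" using assms(1) unfolding toric_data_def I_def by blast
      \<comment> \<open>Passing from \<open>u\<close> to \<open>\<tau>\<close> costs ln 2 at
        \<open>j\<close> and ln 2 times the absolute coordinate at each corner; by the choice of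
        \<open>M\<close> a positive gap remains.\<close>
      have "\<tau> j - (\<Sum>i\<in>\<sigma>. real_of_int (\<mu> \<sigma> j i) * \<tau> i) \<le> - (M - ln 2 * (1 + (\<Sum>i\<in>\<sigma>. \<bar>real_of_int (\<mu> \<sigma> j i)\<bar>)))"
        if j: "j \<in> I - \<sigma>" for j
      proof -
        have "(\<Sum>i\<in>\<sigma>. real_of_int (\<mu> \<sigma> j i) * (u i - \<tau> i)) \<le> (\<Sum>i\<in>\<sigma>. \<bar>real_of_int (\<mu> \<sigma> j i)\<bar> * ln 2)"
        proof (rule sum_mono)
          fix i assume "i \<in> \<sigma>"
          then have "\<bar>u i - \<tau> i\<bar> \<le> ln 2" using \<tau>(2) sub by (simp add: abs_minus_commute subset_iff)
          then have "\<bar>real_of_int (\<mu> \<sigma> j i) * (u i - \<tau> i)\<bar> \<le> \<bar>real_of_int (\<mu> \<sigma> j i)\<bar> * ln 2"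
            unfolding abs_mult by (intro mult_left_mono) auto
          then show "real_of_int (\<mu> \<sigma> j i) * (u i - \<tau> i) \<le> \<bar>real_of_int (\<mu> \<sigma> j i)\<bar> * ln 2" by linarith
        qed
        then have "(\<Sum>i\<in>\<sigma>. real_of_int (\<mu> \<sigma> j i) * u i) - (\<Sum>i\<in>\<sigma>. real_of_int (\<mu> \<sigma> j i) * \<tau> i)
           \<le> ln 2 * (\<Sum>i\<in>\<sigma>. \<bar>real_of_int (\<mu> \<sigma> j i)\<bar>)"
          by (simp add: left_diff_distrib sum_subtractf sum_distrib_left mult.commute)
        moreover have "\<tau> j \<le> u j + ln 2" using \<tau>(2)[of j] j by auto
        ultimately show ?thesis using gap[OF \<sigma> j] by (simp add: distrib_left)
      qed
      then obtain w h where wh: "\<forall>i\<in>\<sigma>. \<tau> i + ptR b i \<bullet> w = h"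
        "\<forall>j\<in>I - \<sigma>. \<tau> j + ptR b j \<bullet> w \<le> h - (M - ln 2 * (1 + (\<Sum>i\<in>\<sigma>. \<bar>real_of_int (\<mu> \<sigma> j i)\<bar>)))"
        using triangle_vertex_with_gap[OF uni[OF \<sigma>], of "I - \<sigma>" "\<mu> \<sigma>" \<tau>
            "\<lambda>j. M - ln 2 * (1 + (\<Sum>i\<in>\<sigma>. \<bar>real_of_int (\<mu> \<sigma> j i)\<bar>))"] \<mu>[OF \<sigma>] by blast
      have "\<tau> j + ptR b j \<bullet> w < h" if "j \<in> I - \<sigma>" for j
        using bspec[OF wh(2) that] M(3)[rule_format, OF \<sigma>, of j] that by auto
      with wh(1) show "\<exists>w h. (\<forall>i\<in>\<sigma>. \<tau> i + ptR b i \<bullet> w = h) \<and> (\<forall>j\<in>idx p - \<sigma>. \<tau> j + ptR b j \<bullet> w < h)"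
        unfolding I_def by blast
    qed
    moreover have "comp_affine (mirrorH b p s q) = (\<lambda>i. (\<tau> i, ptR b i)) ` idx p"
      using \<tau>(1) unfolding H unfolding I_def .
    ultimately show ?thesis by (rule regular_triangulation.dual_subdivisions_spine_cells)
  qed
  then show ?thesis by (intro exI[of _ "exp (- M)"]) auto
qed

end
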